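(* Consider binary interval consensus on the star network with $n>1$ nodes, i.e. with contact rates $q_{1,i}=q_{i,1}=1/(n-1)$ for $i=2,\dots,n$ and $q_{i,j}=0$ otherwise, started with $\alpha n$ nodes in state $0$ and $(1-\alpha)n$ nodes in state $1$, where $\alpha\in(1/2,1]$ is fixed and $\alpha n$ is an integer. For $i=1,2$ let $T_i$ be the duration of convergence phase $i$. Then for $i=1$ and $i=2$ $$\mathbb{E}(T_i)\le\frac{1}{2\alpha-1}\,n(\log(n)+1).$$
   Context: Binary interval consensus with contact rates $Q=(q_{i,j})$ on $V=\{1,\dots,n\}$ ($Q$ symmetric, non-negative, zero diagonal): each unordered pair of nodes $\{i,j\}$ gets in contact at the instances of a Poisson process of rate $q_{i,j}$, independently over pairs. At each time every node is in one of the four states $0,e_0,e_1,1$. When two nodes get in contact their states are updated as follows (first node, second node): $(0,1)\to(e_1,e_0)$; $(e_0,1)\to(1,e_1)$; $(e_1,0)\to(0,e_0)$; $(e_0,0)\to(0,e_0)$; $(e_1,1)\to(1,e_1)$; $(e_0,e_1)\to(e_1,e_0)$. For any other pair of states nothing changes. Phase 1 begins at time $0$ and lasts until none of the nodes is in state $1$. Phase 2 follows the end of phase 1 and lasts until none of the nodes is in state $e_1$. *)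

theory Defs
  imports "HOL-Probability.Probability"
begin

section \<open>Poisson processes\<close>

text \<open>
  The counting process of a Poisson process on the half-line. The law of the increments is written
  out instead of using \<^const>\<open>poisson_pmf\<close>, which is only specified for positive rates:
  for \<open>q = 0\<close> the formula below says that almost surely nothing ever happens.
\<close>

definition (in prob_space) poisson_process :: "real \<Rightarrow> (real \<Rightarrow> 'a \<Rightarrow> nat) \<Rightarrow> bool" where
  "poisson_process q N \<longleftrightarrow>
     (\<forall>t\<ge>0. random_variable (count_space UNIV) (N t)) \<and>
     (AE \<omega> in M. N 0 \<omega> = 0 \<and> mono_on {0..} (\<lambda>t. N t \<omega>) \<and>
        (\<forall>t\<ge>0. ((\<lambda>s. N s \<omega>) \<longlongrightarrow> N t \<omega>) (at_right t))) \<and>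
     (\<forall>s t k. 0 \<le> s \<and> s \<le> t \<longrightarrow>
        prob {\<omega> \<in> space M. N t \<omega> - N s \<omega> = k} =
          exp (- (q * (t - s))) * (q * (t - s)) ^ k / fact k) \<and>
     (\<forall>\<tau> :: nat \<Rightarrow> real. 0 \<le> \<tau> 0 \<and> mono \<tau> \<longrightarrow>
        indep_vars (\<lambda>_. count_space UNIV) (\<lambda>j \<omega>. N (\<tau> (Suc j)) \<omega> - N (\<tau> j) \<omega>) UNIV)"

section \<open>Pairwise contacts\<close>

text \<open>The unordered pair \<open>{i, j}\<close> of distinct nodes is represented by \<open>(i, j)\<close> with \<open>i < j\<close>.\<close>

definition node_pairs :: "nat \<Rightarrow> (nat \<times> nat) set" where
  "node_pairs n = {(i, j). 1 \<le> i \<and> i < j \<and> j \<le> n}"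

locale pairwise_contacts = prob_space M
  for M :: "'a measure" +
  fixes n :: nat
    and Q :: "nat \<Rightarrow> nat \<Rightarrow> real"
    and N :: "nat \<times> nat \<Rightarrow> real \<Rightarrow> 'a \<Rightarrow> nat"
  assumes rates_sym: "\<And>i j. i \<in> {1..n} \<Longrightarrow> j \<in> {1..n} \<Longrightarrow> Q i j = Q j i"
    and rates_nonneg: "\<And>i j. i \<in> {1..n} \<Longrightarrow> j \<in> {1..n} \<Longrightarrow> 0 \<le> Q i j"
    and rates_diag: "\<And>i. i \<in> {1..n} \<Longrightarrow> Q i i = 0"
    and contacts_poisson: "\<And>i j. (i, j) \<in> node_pairs n \<Longrightarrow> poisson_process (Q i j) (N (i, j))"
    and contacts_indep:
      "indep_vars (\<lambda>_. \<Pi>\<^sub>M t\<in>{0..}. count_space UNIV) (\<lambda>p \<omega>. \<lambda>t\<in>{0..}. N p t \<omega>) (node_pairs n)"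

text \<open>A contact instance of a pair is a positive time at which its counting path jumps.\<close>

definition contact_at :: "(nat \<times> nat \<Rightarrow> real \<Rightarrow> nat) \<Rightarrow> nat \<times> nat \<Rightarrow> real \<Rightarrow> bool" where
  "contact_at c p t \<longleftrightarrow> 0 < t \<and> (\<forall>s. 0 \<le> s \<and> s < t \<longrightarrow> c p s < c p t)"

section \<open>Binary interval consensus\<close>

datatype node_state = S0 | E0 | E1 | S1

text \<open>
  Contacts are between unordered pairs, so each update rule is also listed with the two nodes
  exchanged.
\<close>

fun interact :: "node_state \<Rightarrow> node_state \<Rightarrow> node_state \<times> node_state" where
  "interact S0 S1 = (E1, E0)"
| "interact S1 S0 = (E0, E1)"
| "interact E0 S1 = (S1, E1)"
| "interact S1 E0 = (E1, S1)"
| "interact E1 S0 = (S0, E0)"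
| "interact S0 E1 = (E0, S0)"
| "interact E0 S0 = (S0, E0)"
| "interact S0 E0 = (E0, S0)"
| "interact E1 S1 = (S1, E1)"
| "interact S1 E1 = (E1, S1)"
| "interact E0 E1 = (E1, E0)"
| "interact E1 E0 = (E0, E1)"
| "interact x y = (x, y)"

definition update_pair :: "nat \<times> nat \<Rightarrow> (nat \<Rightarrow> node_state) \<Rightarrow> (nat \<Rightarrow> node_state)" where
  "update_pair p x = (case p of (i, j) \<Rightarrow>
     x(i := fst (interact (x i) (x j)), j := snd (interact (x i) (x j))))"

text \<open>
  The configuration at time \<open>t\<close> for one realization \<open>c\<close> of the counting paths: starting from \<open>x0\<close>,
  the contacts during \<open>(0, t]\<close> are processed in chronological order. Almost surely there are finitely
  many of them and no two pairs are in contact at the same instant, so that \<open>THE\<close> and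
  \<^const>\<open>sorted_list_of_set\<close> have their intended values.
\<close>

definition consensus_state ::
    "nat \<Rightarrow> (nat \<Rightarrow> node_state) \<Rightarrow> (nat \<times> nat \<Rightarrow> real \<Rightarrow> nat) \<Rightarrow> real \<Rightarrow> nat \<Rightarrow> node_state" where
  "consensus_state n x0 c t =
     fold (\<lambda>s. update_pair (THE p. p \<in> node_pairs n \<and> contact_at c p s))
       (sorted_list_of_set {s. s \<le> t \<and> (\<exists>p\<in>node_pairs n. contact_at c p s)}) x0"

text \<open>
  Phase durations take the value \<open>\<infinity>\<close> when the phase never ends (or, for the second phase, never
  begins).
\<close>

definition phase1_duration ::
    "nat \<Rightarrow> (nat \<Rightarrow> node_state) \<Rightarrow> (nat \<times> nat \<Rightarrow> real \<Rightarrow> nat) \<Rightarrow> ennreal" where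
  "phase1_duration n x0 c =
     Inf {ennreal t | t. 0 \<le> t \<and> (\<forall>i\<in>{1..n}. consensus_state n x0 c t i \<noteq> S1)}"

definition phase2_duration ::
    "nat \<Rightarrow> (nat \<Rightarrow> node_state) \<Rightarrow> (nat \<times> nat \<Rightarrow> real \<Rightarrow> nat) \<Rightarrow> ennreal" where
  "phase2_duration n x0 c =
     Inf {ennreal s | s t. 0 \<le> s \<and> 0 \<le> t \<and> phase1_duration n x0 c = ennreal t \<and>
            (\<forall>i\<in>{1..n}. consensus_state n x0 c (t + s) i \<noteq> E1)}"

section \<open>The star network\<close>

definition star_rates :: "nat \<Rightarrow> nat \<Rightarrow> nat \<Rightarrow> real" where
  "star_rates n i j =
     (if (i = 1 \<and> j \<in> {2..n}) \<or> (j = 1 \<and> i \<in> {2..n}) then 1 / (real n - 1) else 0)"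

end

theory Submission
  imports Defs
begin

text \<open>
  Put \<open>c = 2 * \<alpha> - 1\<close> and measure time in units of \<open>n - 1\<close>, so that the hub meets every leaf at rate
  one. Each update rule preserves the difference between the numbers of nodes in \<^const>\<open>S0\<close> and in
  \<^const>\<open>S1\<close>, which is therefore \<open>c * n\<close> forever: strong zeros always outnumber strong ones by \<open>c * n\<close>.

  In phase 1 let every leaf in state \<^const>\<open>S1\<close> weigh \<open>1\<close> and let the hub, when it is in that
  state, weigh \<open>1 - c\<close>; let \<open>V\<close> be the total weight. The drift of \<open>V\<close>, the sum over the leaves
  of its change by a contact with that leaf, is at most \<open>- c * V\<close>. A hub in a weak state takes
  over the \<^const>\<open>S1\<close> of a leaf, at a loss of \<open>c\<close>; a hub in \<^const>\<open>S0\<close> destroys it, at a loss of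
  \<open>1\<close>; a hub in \<^const>\<open>S1\<close> loses \<open>1 - c\<close> to every leaf in \<^const>\<open>S0\<close> and gains \<open>c\<close> from every weak leaf,
  and the surplus of zeros makes the losses win. Once no node is in \<^const>\<open>S1\<close>, the nodes in
  \<^const>\<open>E1\<close> move and die by the same scheme, so the same weights serve phase 2
  (\<open>hub_weighted_drift\<close>).

  Exponential decay of \<open>V\<close> becomes a bound on the expected time through a logarithm. Unless it
  vanishes, \<open>V\<close> is between \<open>1 - c\<close> and \<open>n * (1 - c)\<close>. The potential \<open>(ln (V / (1 - c)) + 1) / c\<close>,
  read as \<open>0\<close> for \<open>V = 0\<close>, has drift at most \<open>- 1\<close> while the phase lasts because it lies below its
  tangents (\<open>relative_log_tangent\<close>), and it never exceeds \<open>(ln n + 1) / c\<close>. Hence a phase lasts at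
  most \<open>(n - 1) * (ln n + 1) / c\<close> in expectation. For phase 2 the potential is kept constant at
  this maximal value while phase 1 is running. This has drift at most \<open>0\<close>, so that the random
  time at which phase 2 begins needs no strong Markov property.

  The step from a drift to an expected time (\<open>expected_sojourn_le\<close>) is made without
  continuous-time martingales. Cut time into cells of length \<open>h\<close>. The cells are independent, and
  the chain that performs only the contacts that are alone in their cell is a Markov chain for
  which the argument is a telescoping sum (\<open>expected_grid_occupation\<close>). Two contacts in one of \<open>K\<close>
  cells have probability of order \<open>K * h\<^sup>2\<close>; otherwise the chain agrees with the process at the
  grid points. A phase is at most \<open>h\<close> longer than \<open>h\<close> times the number of grid points in it, and
  the bound follows by refining the grid on a bounded time interval, then by letting the
  interval grow.
\<close>

section \<open>Contacts seen through a time grid\<close>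

abbreviation contact_instants :: "nat \<Rightarrow> (nat \<times> nat \<Rightarrow> real \<Rightarrow> nat) \<Rightarrow> real \<Rightarrow> real set" where
  "contact_instants n c t \<equiv> {s. s \<le> t \<and> (\<exists>p\<in>node_pairs n. contact_at c p s)}"

abbreviation contact_update ::
    "nat \<Rightarrow> (nat \<times> nat \<Rightarrow> real \<Rightarrow> nat) \<Rightarrow> real \<Rightarrow> (nat \<Rightarrow> node_state) \<Rightarrow> (nat \<Rightarrow> node_state)" where
  "contact_update n c s \<equiv> update_pair (THE p. p \<in> node_pairs n \<and> contact_at c p s)"

text \<open>
  Under this condition the contact instants can be listed in order, each with its unique pair, and
  the definite description and the sorted list behind \<^const>\<open>consensus_state\<close> denote what they should.
\<close>

definition simple_contacts :: "nat \<Rightarrow> (nat \<times> nat \<Rightarrow> real \<Rightarrow> nat) \<Rightarrow> bool" where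
  "simple_contacts n c \<longleftrightarrow> (\<forall>t. finite (contact_instants n c t)) \<and>
     (\<forall>s. \<forall>p\<in>node_pairs n. \<forall>p'\<in>node_pairs n. contact_at c p s \<longrightarrow> contact_at c p' s \<longrightarrow> p = p')"

lemma finite_node_pairs: "finite (node_pairs n)"
proof -
  have "node_pairs n \<subseteq> {1..n} \<times> {1..n}" by (auto simp: node_pairs_def)
  then show ?thesis by (rule finite_subset) simp
qed

lemma sorted_list_of_set_append:
  fixes A B :: "'b::linorder set"
  assumes "finite A" "finite B" "\<And>a b. a \<in> A \<Longrightarrow> b \<in> B \<Longrightarrow> a < b"
  shows "sorted_list_of_set (A \<union> B) = sorted_list_of_set A @ sorted_list_of_set B"
proof (rule sorted_distinct_set_unique)
  show "sorted (sorted_list_of_set A @ sorted_list_of_set B)"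
    using assms by (auto simp: sorted_append less_imp_le)
  show "distinct (sorted_list_of_set A @ sorted_list_of_set B)"
    using assms by fastforce
qed (use assms in auto)

lemma consensus_state_later:
  assumes fin: "finite (contact_instants n c t')" and "t \<le> t'"
  shows "consensus_state n x0 c t' =
    fold (contact_update n c) (sorted_list_of_set (contact_instants n c t' - contact_instants n c t))
      (consensus_state n x0 c t)"
proof -
  let ?A = "contact_instants n c t" and ?B = "contact_instants n c t' - contact_instants n c t"
  have eq: "contact_instants n c t' = ?A \<union> ?B" using \<open>t \<le> t'\<close> by auto
  have "finite ?A" by (rule finite_subset[OF _ fin]) (use \<open>t \<le> t'\<close> in auto)
  moreover have "finite ?B" using fin by auto
  moreover have "a < b" if "a \<in> ?A" "b \<in> ?B" for a b using that by auto
  ultimately have "sorted_list_of_set (contact_instants n c t') = sorted_list_of_set ?A @ sorted_list_of_set ?B"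
    by (subst eq, intro sorted_list_of_set_append) auto
  then show ?thesis by (simp add: consensus_state_def)
qed

lemma consensus_state_invariant:
  assumes c: "simple_contacts n c" and "t \<le> t'" and init: "P (consensus_state n x0 c t)"
    and step: "\<And>p x. p \<in> node_pairs n \<Longrightarrow> P x \<Longrightarrow> P (update_pair p x)"
  shows "P (consensus_state n x0 c t')"
proof -
  have fin: "finite (contact_instants n c t')" using c by (simp add: simple_contacts_def)
  have "P (fold (contact_update n c) ss x)"
    if "P x" "set ss \<subseteq> contact_instants n c t'" for ss x
    using that
  proof (induction ss arbitrary: x)
    case (Cons s ss)
    then obtain p where p: "p \<in> node_pairs n" "contact_at c p s" by auto
    have "(THE p. p \<in> node_pairs n \<and> contact_at c p s) = p"
      using p c unfolding simple_contacts_def by (intro the_equality) blast+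
    then show ?case using Cons p step by simp
  qed simp
  then show ?thesis
    unfolding consensus_state_later[OF fin \<open>t \<le> t'\<close>] using init fin by simp
qed

text \<open>
  Finitely many contact instants leave a gap after every time, which gives right-continuity in the
  discrete space of configurations.
\<close>

lemma consensus_state_right_constant:
  assumes c: "simple_contacts n c"
  obtains e where "0 < e" "\<And>u. t \<le> u \<Longrightarrow> u < t + e \<Longrightarrow> consensus_state n x0 c u = consensus_state n x0 c t"
proof -
  let ?F = "contact_instants n c (t + 1) - contact_instants n c t"
  have fin: "finite ?F" using c by (simp add: simple_contacts_def)
  define m where "m = Min (insert (t + 1) ?F)"
  have "t < m" unfolding m_def using fin by auto
  have m_le: "m \<le> s" if "s \<in> insert (t + 1) ?F" for s unfolding m_def using fin that by simp
  show thesis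
  proof (rule that[of "m - t"])
    fix u assume u: "t \<le> u" "u < t + (m - t)"
    have "s \<le> t" if "s \<le> u" "\<exists>p\<in>node_pairs n. contact_at c p s" for s
    proof (rule ccontr)
      assume "\<not> s \<le> t"
      then have "m \<le> s" using that u m_le[of "t + 1"] by (intro m_le) auto
      then show False using that u by simp
    qed
    then have "contact_instants n c u = contact_instants n c t" using u by force
    then show "consensus_state n x0 c u = consensus_state n x0 c t" by (simp add: consensus_state_def)
  qed (use \<open>t < m\<close> in simp)
qed

text \<open>
  The part of the definition of a Poisson process that concerns single trajectories.
\<close>

definition counting_paths :: "nat \<Rightarrow> (nat \<times> nat \<Rightarrow> real \<Rightarrow> nat) \<Rightarrow> bool" where
  "counting_paths n c \<longleftrightarrow> (\<forall>p\<in>node_pairs n. mono_on {0..} (c p) \<and>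
     (\<forall>t\<ge>0. (c p \<longlongrightarrow> c p t) (at_right t)))"

lemma contact_at_less:
  "contact_at c p s \<Longrightarrow> 0 \<le> r \<Longrightarrow> r < s \<Longrightarrow> c p r < c p s"
  by (simp add: contact_at_def)

text \<open>
  The infimum of the times at which the path exceeds its value at \<open>a\<close> is attained by
  right-continuity, hence it is a contact instant.
\<close>

lemma counting_path_contact_exists:
  assumes c: "counting_paths n c" "p \<in> node_pairs n" and ab: "0 \<le> a" "a \<le> b" "c p a < c p b"
  obtains s where "a < s" "s \<le> b" "contact_at c p s"
proof -
  have mono: "c p u \<le> c p v" if "0 \<le> u" "u \<le> v" for u v
    using c that by (auto simp: counting_paths_def dest!: bspec intro: mono_onD)
  define A where "A = {s. a \<le> s \<and> s \<le> b \<and> c p a < c p s}"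
  define s where "s = Inf A"
  have bA: "b \<in> A" using ab by (simp add: A_def)
  have bdd: "bdd_below A" by (auto simp: A_def intro!: bdd_belowI[of _ a])
  have "s \<le> b" unfolding s_def using bA bdd by (rule cInf_lower)
  have "a \<le> s" unfolding s_def using bA by (intro cInf_greatest) (auto simp: A_def)
  have below: "c p u \<le> c p a" if "a \<le> u" "u < s" for u
  proof (rule ccontr)
    assume "\<not> c p u \<le> c p a"
    then have "u \<in> A" using that \<open>s \<le> b\<close> by (simp add: A_def)
    then have "s \<le> u" unfolding s_def using bdd by (rule cInf_lower)
    then show False using that by simp
  qed
  have jump: "c p a < c p s"
  proof (rule ccontr)
    assume not: "\<not> c p a < c p s"
    have "(c p \<longlongrightarrow> c p s) (at_right s)" using c \<open>a \<le> s\<close> ab by (auto simp: counting_paths_def)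
    then have "eventually (\<lambda>u. c p u = c p s) (at_right s)" by (simp add: tendsto_discrete)
    then obtain e where e: "s < e" "\<And>u. s < u \<Longrightarrow> u < e \<Longrightarrow> c p u = c p s"
      by (auto simp: eventually_at_right_field)
    have "e \<le> u" if "u \<in> A" for u
    proof (rule ccontr)
      assume "\<not> e \<le> u"
      moreover have "s \<le> u" unfolding s_def using that bdd by (rule cInf_lower)
      ultimately have "c p u = c p s" using e(2)[of u] by (cases "u = s") auto
      then show False using that not by (simp add: A_def)
    qed
    then have "e \<le> s" unfolding s_def using bA by (intro cInf_greatest) auto
    then show False using e by simp
  qed
  then have "a < s" using \<open>a \<le> s\<close> by (cases "a = s") auto
  moreover have "contact_at c p s"
    unfolding contact_at_def
  proof safe
    show "0 < s" using \<open>a < s\<close> ab by simp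
    fix u assume u: "0 \<le> u" "u < s"
    show "c p u < c p s"
    proof (cases "a \<le> u")
      case True then show ?thesis using below[of u] u jump by simp
    next
      case False then show ?thesis using mono[of u a] u jump by simp
    qed
  qed
  ultimately show thesis using \<open>s \<le> b\<close> that by blast
qed

text \<open>
  The argument counts the contacts of each pair within one cell of the grid. The result is \<^const>\<open>None\<close>
  both for an empty cell and for one with several contacts.
\<close>

definition sole_contact :: "nat \<Rightarrow> (nat \<times> nat \<Rightarrow> nat) \<Rightarrow> (nat \<times> nat) option" where
  "sole_contact n d = (if \<exists>p\<in>node_pairs n. \<forall>p'\<in>node_pairs n. d p' = of_bool (p' = p)
     then Some (THE p. p \<in> node_pairs n \<and> (\<forall>p'\<in>node_pairs n. d p' = of_bool (p' = p))) else None)"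

lemma sole_contact_eq_Some_iff:
  "sole_contact n d = Some p \<longleftrightarrow> p \<in> node_pairs n \<and> (\<forall>p'\<in>node_pairs n. d p' = of_bool (p' = p))"
proof -
  have unique: "p = q" if "p \<in> node_pairs n" "\<forall>p'\<in>node_pairs n. d p' = of_bool (p' = p)"
    "\<forall>p'\<in>node_pairs n. d p' = of_bool (p' = q)" for p q
    using bspec[OF that(2) that(1)] bspec[OF that(3) that(1)] by (cases "p = q") simp_all
  have the: "(THE p. p \<in> node_pairs n \<and> (\<forall>p'\<in>node_pairs n. d p' = of_bool (p' = p))) = p"
    if "p \<in> node_pairs n" "\<forall>p'\<in>node_pairs n. d p' = of_bool (p' = p)" for p
    using that unique by (intro the_equality) blast+
  show ?thesis
  proof (cases "\<exists>p\<in>node_pairs n. \<forall>p'\<in>node_pairs n. d p' = of_bool (p' = p)")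
    case True
    then obtain q where q: "q \<in> node_pairs n" "\<forall>p'\<in>node_pairs n. d p' = of_bool (p' = q)" by blast
    have "sole_contact n d = Some q" unfolding sole_contact_def using True the[OF q] by simp
    then show ?thesis using q unique[OF _ _ q(2)] by (metis option.inject)
  next
    case False
    then have "sole_contact n d = None" unfolding sole_contact_def by (rule if_not_P)
    with False show ?thesis by (metis option.distinct(1))
  qed
qed

abbreviation apply_contact :: "(nat \<times> nat) option \<Rightarrow> (nat \<Rightarrow> node_state) \<Rightarrow> (nat \<Rightarrow> node_state)" where
  "apply_contact z x \<equiv> (case z of None \<Rightarrow> x | Some p \<Rightarrow> update_pair p x)"

definition cell_contacts :: "(nat \<times> nat \<Rightarrow> real \<Rightarrow> nat) \<Rightarrow> real \<Rightarrow> nat \<Rightarrow> nat \<times> nat \<Rightarrow> nat" where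
  "cell_contacts c h k p = c p (real (Suc k) * h) - c p (real k * h)"

text \<open>
  The chain that ignores the cells with several contacts. It is driven by an arbitrary sequence of
  cell outcomes so that its independence of later outcomes can be expressed.
\<close>

primrec run_contacts ::
    "(nat \<Rightarrow> (nat \<times> nat) option) \<Rightarrow> (nat \<Rightarrow> node_state) \<Rightarrow> nat \<Rightarrow> (nat \<Rightarrow> node_state)" where
  "run_contacts z x0 0 = x0"
| "run_contacts z x0 (Suc k) = apply_contact (z k) (run_contacts z x0 k)"

abbreviation grid_state ::
    "nat \<Rightarrow> (nat \<Rightarrow> node_state) \<Rightarrow> (nat \<times> nat \<Rightarrow> real \<Rightarrow> nat) \<Rightarrow> real \<Rightarrow> nat \<Rightarrow> (nat \<Rightarrow> node_state)" where
  "grid_state n x0 c h \<equiv> run_contacts (\<lambda>k. sole_contact n (cell_contacts c h k)) x0"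

definition good_grid :: "nat \<Rightarrow> (nat \<times> nat \<Rightarrow> real \<Rightarrow> nat) \<Rightarrow> real \<Rightarrow> nat \<Rightarrow> bool" where
  "good_grid n c h K \<longleftrightarrow> (\<forall>k<K. (\<Sum>p\<in>node_pairs n. cell_contacts c h k p) \<le> 1)"

text \<open>
  A cell whose counts add up to at most one contains at most one contact instant, since every
  contact within the cell raises the count of its pair, and two instants of one pair raise it twice.
\<close>

lemma cell_contacts_cases:
  assumes c: "counting_paths n c" and h: "0 \<le> h"
    and one: "(\<Sum>p\<in>node_pairs n. cell_contacts c h k p) \<le> 1"
  defines "C \<equiv> contact_instants n c (real (Suc k) * h) - contact_instants n c (real k * h)"
  shows "(C = {} \<and> sole_contact n (cell_contacts c h k) = None) \<or>
    (\<exists>s p. C = {s} \<and> sole_contact n (cell_contacts c h k) = Some p \<and>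
       (\<forall>q\<in>node_pairs n. contact_at c q s \<longleftrightarrow> q = p) \<and> p \<in> node_pairs n)"
proof -
  define a b where "a = real k * h" and "b = real (Suc k) * h"
  have ab: "0 \<le> a" "a \<le> b" using h by (auto simp: a_def b_def algebra_simps)
  let ?d = "cell_contacts c h k"
  have d: "?d p = c p b - c p a" for p by (simp add: cell_contacts_def a_def b_def)
  have C: "s \<in> C \<longleftrightarrow> a < s \<and> s \<le> b \<and> (\<exists>p\<in>node_pairs n. contact_at c p s)" for s
    by (auto simp: C_def a_def b_def)
  have mono: "c p u \<le> c p v" if "0 \<le> u" "u \<le> v" "p \<in> node_pairs n" for p u v
    using c that by (auto simp: counting_paths_def dest!: bspec intro: mono_onD)
  have dpos: "?d p \<ge> 1" if "p \<in> node_pairs n" "a < s" "s \<le> b" "contact_at c p s" for p s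
  proof -
    have "c p a < c p s" using that ab by (intro contact_at_less) auto
    also have "c p s \<le> c p b" using that ab by (intro mono) auto
    finally show ?thesis by (simp add: d)
  qed
  show ?thesis
  proof (cases "\<exists>p\<in>node_pairs n. ?d p \<noteq> 0")
    case False
    then have "C = {}" using dpos by (fastforce simp: C)
    moreover have "sole_contact n ?d = None"
      using False sole_contact_eq_Some_iff[of n ?d] by (cases "sole_contact n ?d") auto
    ultimately show ?thesis by simp
  next
    case True
    then obtain p where p: "p \<in> node_pairs n" "?d p \<noteq> 0" by blast
    have "?d p + (\<Sum>q\<in>node_pairs n - {p}. ?d q) \<le> 1"
      using one by (simp add: sum.remove[OF finite_node_pairs p(1)])
    with p have dp: "?d p = 1" and rest: "(\<Sum>q\<in>node_pairs n - {p}. ?d q) = 0" by linarith+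
    from rest have "\<forall>q\<in>node_pairs n - {p}. ?d q = 0" using finite_node_pairs by (subst (asm) sum_eq_0_iff) blast+
    then have dq: "?d q = 0" if "q \<in> node_pairs n" "q \<noteq> p" for q
      using that by blast
    have sole: "sole_contact n ?d = Some p"
      unfolding sole_contact_eq_Some_iff using p dp dq by simp
    have only: "q = p" if "q \<in> node_pairs n" "a < s" "s \<le> b" "contact_at c q s" for q s
      using dpos[OF that] dq[OF that(1)] by auto
    from dp have "c p a < c p b" by (simp add: d)
    then obtain s where s: "a < s" "s \<le> b" "contact_at c p s"
      using counting_path_contact_exists[OF c p(1) ab] by blast
    have unique: False if "a < s" "s < s'" "s' \<le> b" "contact_at c p s" "contact_at c p s'" for s s'
    proof -
      have "c p a < c p s" using that ab by (intro contact_at_less) auto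
      moreover have "c p s < c p s'" using that ab by (intro contact_at_less) auto
      moreover have "c p s' \<le> c p b" using that ab p by (intro mono) auto
      ultimately show False using dp d[of p] by linarith
    qed
    have "C = {s}"
    proof safe
      fix s' assume "s' \<in> C"
      then obtain q where q: "a < s'" "s' \<le> b" "q \<in> node_pairs n" "contact_at c q s'" unfolding C by blast
      then have "contact_at c p s'" using only[of q s'] by simp
      then show "s' = s" using unique[of s s'] unique[of s' s] s q(1,2) by (meson linorder_neqE)
    next
      show "s \<in> C" unfolding C using s p(1) by blast
    qed
    moreover have "\<forall>q\<in>node_pairs n. contact_at c q s \<longleftrightarrow> q = p"
      using s only[of _ s] by blast
    ultimately show ?thesis using sole p(1) by blast
  qed
qed

text \<open>
  On a grid without crowded cells the process passes from one grid point to the next exactly as the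
  chain does. The other two conjuncts, needed for the processing order of the contacts, come out of
  the same induction.
\<close>

lemma good_grid_contacts:
  assumes c: "counting_paths n c" and h: "0 \<le> h" and good: "good_grid n c h K" and "k \<le> K"
  shows "finite (contact_instants n c (real k * h)) \<and>
    (\<forall>s\<in>contact_instants n c (real k * h). \<forall>p\<in>node_pairs n. \<forall>p'\<in>node_pairs n.
       contact_at c p s \<longrightarrow> contact_at c p' s \<longrightarrow> p = p') \<and>
    consensus_state n x0 c (real k * h) = grid_state n x0 c h k"
  using \<open>k \<le> K\<close>
proof (induction k)
  case 0
  have empty: "contact_instants n c 0 = {}" by (auto simp: contact_at_def)
  show ?case by (simp add: consensus_state_def empty del: Collect_empty_eq)
next
  case (Suc k)
  let ?a = "real k * h" and ?b = "real (Suc k) * h"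
  have le: "?a \<le> ?b" using h by (simp add: algebra_simps)
  have le1: "(\<Sum>p\<in>node_pairs n. cell_contacts c h k p) \<le> 1"
    using good Suc.prems unfolding good_grid_def by auto
  define C where "C = contact_instants n c ?b - contact_instants n c ?a"
  have eq: "contact_instants n c ?b = contact_instants n c ?a \<union> C" using le by (auto simp: C_def)
  note IH = Suc.IH[OF Suc_leD[OF Suc.prems]]
  consider (none) "C = {}" "sole_contact n (cell_contacts c h k) = None"
    | (one) s p where "C = {s}" "sole_contact n (cell_contacts c h k) = Some p"
       "\<forall>q\<in>node_pairs n. contact_at c q s \<longleftrightarrow> q = p" "p \<in> node_pairs n"
    using cell_contacts_cases[OF c h le1, folded C_def] by metis
  then have C: "finite C \<and>
     (\<forall>s\<in>C. \<forall>p\<in>node_pairs n. \<forall>p'\<in>node_pairs n. contact_at c p s \<longrightarrow> contact_at c p' s \<longrightarrow> p = p') \<and>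
     (\<forall>x. fold (contact_update n c) (sorted_list_of_set C) x =
        apply_contact (sole_contact n (cell_contacts c h k)) x)"
  proof cases
    case none
    then show ?thesis by simp
  next
    case (one s p)
    have "(THE p. p \<in> node_pairs n \<and> contact_at c p s) = p"
      using one(3,4) by (intro the_equality) blast+
    moreover have "\<forall>p\<in>node_pairs n. \<forall>p'\<in>node_pairs n. contact_at c p s \<longrightarrow> contact_at c p' s \<longrightarrow> p = p'"
      using one(3) by simp
    ultimately show ?thesis using one(1,2) by simp
  qed
  have fin: "finite (contact_instants n c ?b)" unfolding eq using IH C by blast
  moreover have "consensus_state n x0 c ?b = grid_state n x0 c h (Suc k)"
    unfolding consensus_state_later[OF fin le] using IH C unfolding C_def by simp
  moreover have "p = p'" if "s \<in> contact_instants n c ?b" "p \<in> node_pairs n" "p' \<in> node_pairs n"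
    "contact_at c p s" "contact_at c p' s" for s p p'
  proof -
    from that(1) consider "s \<in> contact_instants n c ?a" | "s \<in> C" unfolding eq by (elim UnE)
    then show ?thesis
    proof cases
      case 1
      show ?thesis by (rule IH[THEN conjunct2, THEN conjunct1, rule_format, OF 1 that(2-5)])
    next
      case 2
      show ?thesis by (rule C[THEN conjunct2, THEN conjunct1, rule_format, OF 2 that(2-5)])
    qed
  qed
  ultimately show ?case by simp
qed

lemma simple_contactsI:
  assumes c: "counting_paths n c"
    and good: "\<And>R::nat. \<exists>K>0. good_grid n c (real R / real K) K"
  shows "simple_contacts n c"
  unfolding simple_contacts_def
proof (intro conjI allI ballI impI)
  have *: "finite (contact_instants n c (real R)) \<and> (\<forall>s\<in>contact_instants n c (real R).
    \<forall>p\<in>node_pairs n. \<forall>p'\<in>node_pairs n. contact_at c p s \<longrightarrow> contact_at c p' s \<longrightarrow> p = p')" for R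
  proof -
    obtain K where "K > 0" and "good_grid n c (real R / real K) K" using good by blast
    from good_grid_contacts[OF c _ this(2) order_refl] \<open>K > 0\<close> show ?thesis by auto
  qed
  show "finite (contact_instants n c t)" for t
  proof -
    obtain R where "t \<le> real R" using real_arch_simple by blast
    then have "contact_instants n c t \<subseteq> contact_instants n c (real R)" by auto
    then show ?thesis by (rule finite_subset) (use * in simp)
  qed
  fix s p p' assume "p \<in> node_pairs n" "p' \<in> node_pairs n" "contact_at c p s" "contact_at c p' s"
  note p = this
  obtain R where "s \<le> real R" using real_arch_simple by blast
  then have "s \<in> contact_instants n c (real R)" using p by blast
  then show "p = p'" by (rule *[THEN conjunct2, rule_format, OF _ p])
qed

section \<open>Hitting times of absorbing properties\<close>

text \<open>
  Rational horizons keep the condition countable, so that it holds almost surely.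
\<close>

definition regular_paths :: "nat \<Rightarrow> (nat \<times> nat \<Rightarrow> real \<Rightarrow> nat) \<Rightarrow> bool" where
  "regular_paths n c \<longleftrightarrow> counting_paths n c \<and>
     (\<forall>r\<in>\<rat>. 0 \<le> r \<longrightarrow> (\<exists>K>0. good_grid n c (r / real K) K))"

lemma regular_paths_simple: "regular_paths n c \<Longrightarrow> simple_contacts n c"
  unfolding regular_paths_def by (intro simple_contactsI) auto

lemma good_grid_state:
  assumes "counting_paths n c" "0 \<le> h" "good_grid n c h K" "k \<le> K"
  shows "grid_state n x0 c h k = consensus_state n x0 c (real k * h)"
  using good_grid_contacts[OF assms, of x0] by simp

definition hitting_time ::
    "nat \<Rightarrow> (nat \<Rightarrow> node_state) \<Rightarrow> (nat \<times> nat \<Rightarrow> real \<Rightarrow> nat) \<Rightarrow> ((nat \<Rightarrow> node_state) \<Rightarrow> bool) \<Rightarrow> ennreal" where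
  "hitting_time n x0 c B = Inf {ennreal t | t. 0 \<le> t \<and> B (consensus_state n x0 c t)}"

definition absorbing :: "nat \<Rightarrow> ((nat \<Rightarrow> node_state) \<Rightarrow> bool) \<Rightarrow> bool" where
  "absorbing n B \<longleftrightarrow> (\<forall>p\<in>node_pairs n. \<forall>x. B x \<longrightarrow> B (update_pair p x))"

lemma absorbing_stays:
  assumes "regular_paths n c" "absorbing n B" "t \<le> t'" "B (consensus_state n x0 c t)"
  shows "B (consensus_state n x0 c t')"
  using assms consensus_state_invariant[OF regular_paths_simple, of n c t t' B x0]
  unfolding absorbing_def by blast

lemma hitting_time_le: "0 \<le> t \<Longrightarrow> B (consensus_state n x0 c t) \<Longrightarrow> hitting_time n x0 c B \<le> ennreal t"
  unfolding hitting_time_def by (intro Inf_lower) auto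

lemma hitting_time_less:
  assumes c: "regular_paths n c" "absorbing n B" and t: "hitting_time n x0 c B < ennreal t"
  shows "B (consensus_state n x0 c t)"
proof -
  obtain t' where t': "0 \<le> t'" "B (consensus_state n x0 c t')" "ennreal t' < ennreal t"
    using t unfolding hitting_time_def Inf_less_iff by auto
  then have "t' \<le> t" by (simp add: ennreal_less_iff)
  then show ?thesis using absorbing_stays[OF c _ t'(2)] by simp
qed

text \<open>
  The infimum is a minimum, because the configuration does not change immediately after any time.
\<close>

lemma hitting_time_attained:
  assumes c: "regular_paths n c" "absorbing n B" and t: "hitting_time n x0 c B = ennreal t" "0 \<le> t"
  shows "B (consensus_state n x0 c t)"
proof -
  obtain e where e: "0 < e" "\<And>u. t \<le> u \<Longrightarrow> u < t + e \<Longrightarrow> consensus_state n x0 c u = consensus_state n x0 c t"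
    using consensus_state_right_constant[OF regular_paths_simple[OF c(1)]] by metis
  have "hitting_time n x0 c B < ennreal (t + e / 2)"
    unfolding t(1) using e(1) t(2) by (intro ennreal_lessI) auto
  then have "B (consensus_state n x0 c (t + e / 2))" by (rule hitting_time_less[OF c])
  then show ?thesis using e(2)[of "t + e / 2"] e(1) by simp
qed

text \<open>
  For an absorbing property only rational times matter. This reduces measurability of the hitting
  time to that of countably many events.
\<close>

lemma hitting_time_rational:
  assumes c: "regular_paths n c" "absorbing n B"
  shows "hitting_time n x0 c B =
    (INF r\<in>\<rat> \<inter> {0..}. if B (consensus_state n x0 c r) then ennreal r else top)"
proof (rule antisym)
  show "hitting_time n x0 c B \<le> (INF r\<in>\<rat> \<inter> {0..}. if B (consensus_state n x0 c r) then ennreal r else top)"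
    by (intro INF_greatest) (auto intro: hitting_time_le)
  show "(INF r\<in>\<rat> \<inter> {0..}. if B (consensus_state n x0 c r) then ennreal r else top) \<le> hitting_time n x0 c B"
    (is "?I \<le> _")
    unfolding hitting_time_def
  proof (rule Inf_greatest, safe)
    fix t :: real assume t: "0 \<le> t" "B (consensus_state n x0 c t)"
    show "?I \<le> ennreal t"
    proof (rule ennreal_le_epsilon)
      fix e :: real assume "0 < e"
      then obtain r where r: "r \<in> \<rat>" "t < r" "r < t + e" using Rats_dense_in_real[of t "t + e"] by auto
      have "?I \<le> (if B (consensus_state n x0 c r) then ennreal r else top)"
        using r t by (intro INF_lower) auto
      also have "\<dots> = ennreal r" using absorbing_stays[OF c _ t(2), of r] r by simp
      also have "\<dots> \<le> ennreal (t + e)" using r by (intro ennreal_leI) simp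
      finally show "?I \<le> ennreal t + ennreal e" using t \<open>0 < e\<close> by (simp add: ennreal_plus)
    qed
  qed
qed

lemma many_grid_points_between:
  fixes s b h :: real and K :: nat
  assumes h: "0 < h" and s: "0 \<le> s" and b: "b \<le> real K * h"
  shows "b - s \<le> h + h * real (card {k. k < K \<and> s < real k * h \<and> real k * h < b})"
proof -
  define m where "m = nat \<lfloor>s / h\<rfloor> + 1"
  define m' where "m' = nat \<lceil>b / h\<rceil>"
  have "{m..<m'} \<subseteq> {k. k < K \<and> s < real k * h \<and> real k * h < b}"
  proof
    fix k assume k: "k \<in> {m..<m'}"
    have "0 \<le> s / h" using h s by simp
    then have "\<lfloor>s / h\<rfloor> < int k" using k by (auto simp: m_def)
    then have "s / h < real k" by linarith
    moreover have "int k < \<lceil>b / h\<rceil>" using k by (auto simp: m'_def)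
    then have "real k < b / h" by linarith
    ultimately have "s < real k * h" and kb: "real k * h < b" using h by (simp_all add: field_simps)
    moreover have "real k * h < real K * h" using kb b by linarith
    then have "k < K" using h by simp
    ultimately show "k \<in> {k. k < K \<and> s < real k * h \<and> real k * h < b}" by simp
  qed
  then have "card {m..<m'} \<le> card {k. k < K \<and> s < real k * h \<and> real k * h < b}"
    by (rule card_mono[rotated]) simp
  then have "real m' - real m \<le> real (card {k. k < K \<and> s < real k * h \<and> real k * h < b})" by simp
  moreover have "b / h \<le> real m'" unfolding m'_def by linarith
  moreover have "real m \<le> s / h + 1"
  proof -
    have "0 \<le> s / h" using h s by simp
    then show ?thesis unfolding m_def by linarith
  qed
  ultimately have "b / h - s / h \<le> 1 + real (card {k. k < K \<and> s < real k * h \<and> real k * h < b})" by linarith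
  then show ?thesis using h by (simp add: field_simps)
qed

section \<open>Independence of the cells of a grid\<close>

text \<open>
  Independence across the pairs, jointly over all times, and independence in time for each pair are
  given separately. Here they are combined: an event about finitely many \<open>(i, j)\<close> is an intersection
  over \<open>i\<close> of events about \<open>Y i\<close>, each of which factors over \<open>j\<close>.
\<close>

lemma (in prob_space) indep_vars_Sigma:
  assumes outer: "indep_vars M' Y I"
    and inner: "\<And>i. i \<in> I \<Longrightarrow> indep_vars (N' i) (\<lambda>j \<omega>. f i j (Y i \<omega>)) (J i)"
    and f: "\<And>i j. i \<in> I \<Longrightarrow> j \<in> J i \<Longrightarrow> f i j \<in> measurable (M' i) (N' i j)"
  shows "indep_vars (\<lambda>(i, j). N' i j) (\<lambda>(i, j) \<omega>. f i j (Y i \<omega>)) (Sigma I J)"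
proof -
  have Y: "random_variable (M' i) (Y i)" if "i \<in> I" for i
    using outer that by (simp add: indep_vars_def2)
  have rv: "random_variable (N' i j) (\<lambda>\<omega>. f i j (Y i \<omega>))" if "i \<in> I" "j \<in> J i" for i j
    using Y[OF that(1)] f[OF that] by (rule measurable_compose)
  let ?Z = "\<lambda>(i, j) \<omega>. f i j (Y i \<omega>)"
  have "indep_sets (\<lambda>x. {?Z x -` A \<inter> space M |A. A \<in> sets ((\<lambda>(i, j). N' i j) x)}) (Sigma I J)"
  proof (rule indep_setsI)
    fix x assume "x \<in> Sigma I J"
    then show "{?Z x -` A \<inter> space M |A. A \<in> sets ((\<lambda>(i, j). N' i j) x)} \<subseteq> events"
      using rv by (force intro: measurable_sets)
  next
    fix A F assume F: "F \<noteq> {}" "F \<subseteq> Sigma I J" "finite F"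
      and A: "\<forall>x\<in>F. A x \<in> {?Z x -` A \<inter> space M |A. A \<in> sets ((\<lambda>(i, j). N' i j) x)}"
    then have "\<forall>x\<in>F. \<exists>B. B \<in> sets (N' (fst x) (snd x)) \<and> A x = (\<lambda>\<omega>. f (fst x) (snd x) (Y (fst x) \<omega>)) -` B \<inter> space M"
      by (fastforce simp: split_beta)
    then obtain B where B: "\<And>i j. (i, j) \<in> F \<Longrightarrow> B (i, j) \<in> sets (N' i j)"
      "\<And>i j. (i, j) \<in> F \<Longrightarrow> A (i, j) = (\<lambda>\<omega>. f i j (Y i \<omega>)) -` B (i, j) \<inter> space M"
      by (metis fst_conv snd_conv)
    define G where "G = fst ` F"
    define S where "S i = {j. (i, j) \<in> F}" for i
    have G: "G \<noteq> {}" "finite G" "G \<subseteq> I" using F by (auto simp: G_def)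
    have S: "S i \<noteq> {}" "finite (S i)" "S i \<subseteq> J i" if "i \<in> G" for i
    proof -
      have "S i \<subseteq> snd ` F" by (force simp: S_def)
      then show "finite (S i)" using F by (blast intro: finite_subset)
    qed (use F that in \<open>auto simp: S_def G_def\<close>)
    have FS: "F = Sigma G S" by (force simp: G_def S_def)
    define C where "C i = {y \<in> space (M' i). \<forall>j\<in>S i. f i j y \<in> B (i, j)}" for i
    have C: "C i \<in> sets (M' i)" if "i \<in> G" for i
      unfolding C_def
    proof (rule sets.sets_Collect_finite_All)
      fix j assume "j \<in> S i"
      then have "f i j \<in> measurable (M' i) (N' i j)" "B (i, j) \<in> sets (N' i j)"
        using f that S[OF that] G B(1)[of i j] by (auto simp: S_def)
      then show "{y \<in> space (M' i). f i j y \<in> B (i, j)} \<in> sets (M' i)" by simp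
    qed (use S that in auto)
    have CA: "Y i -` C i \<inter> space M = (\<Inter>j\<in>S i. (\<lambda>\<omega>. f i j (Y i \<omega>)) -` B (i, j) \<inter> space M)" if "i \<in> G" for i
      using S[OF that] Y[THEN measurable_space, of i] that G by (auto simp: C_def)
    have "prob (\<Inter>x\<in>F. A x) = prob (\<Inter>i\<in>G. Y i -` C i \<inter> space M)"
    proof (rule arg_cong[of _ _ prob])
      have "(\<Inter>x\<in>F. A x) = (\<Inter>i\<in>G. \<Inter>j\<in>S i. A (i, j))" by (force simp: FS)
      also have "\<dots> = (\<Inter>i\<in>G. Y i -` C i \<inter> space M)"
        using CA B(2) by (auto simp: S_def)
      finally show "(\<Inter>x\<in>F. A x) = (\<Inter>i\<in>G. Y i -` C i \<inter> space M)" .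
    qed
    also have "\<dots> = (\<Prod>i\<in>G. prob (Y i -` C i \<inter> space M))"
      using G C by (intro indep_varsD[OF outer])
    also have "\<dots> = (\<Prod>i\<in>G. \<Prod>j\<in>S i. prob (A (i, j)))"
    proof (rule prod.cong[OF refl])
      fix i assume i: "i \<in> G"
      have "prob (Y i -` C i \<inter> space M) = (\<Prod>j\<in>S i. prob ((\<lambda>\<omega>. f i j (Y i \<omega>)) -` B (i, j) \<inter> space M))"
        unfolding CA[OF i] using S[OF i] i G B(1) by (intro indep_varsD[OF inner]) (auto simp: S_def)
      then show "prob (Y i -` C i \<inter> space M) = (\<Prod>j\<in>S i. prob (A (i, j)))"
        using B(2) by (simp add: S_def)
    qed
    also have "\<dots> = (\<Prod>x\<in>F. prob (A x))"
      unfolding FS using G S by (subst prod.Sigma) auto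
    finally show "prob (\<Inter>x\<in>F. A x) = (\<Prod>x\<in>F. prob (A x))" .
  qed
  then show ?thesis unfolding indep_vars_def2 using rv by auto
qed

lemma measurable_diff_nat:
  fixes f g :: "'b \<Rightarrow> nat"
  assumes f: "f \<in> measurable M' (count_space UNIV)" and g: "g \<in> measurable M' (count_space UNIV)"
  shows "(\<lambda>x. f x - g x) \<in> measurable M' (count_space UNIV)"
  by (rule measurable_compose_countable[OF _ g, where f = "\<lambda>i x. f x - i"])
     (rule measurable_compose[OF f], simp)

lemma (in prob_space) expectation_of_bool:
  assumes "{\<omega> \<in> space M. P \<omega>} \<in> events"
  shows "expectation (\<lambda>\<omega>. of_bool (P \<omega>) :: real) = prob {\<omega> \<in> space M. P \<omega>}"
proof -
  have "expectation (\<lambda>\<omega>. of_bool (P \<omega>) :: real) = expectation (indicator {\<omega> \<in> space M. P \<omega>})"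
    by (intro Bochner_Integration.integral_cong refl) (simp add: indicator_def)
  then show ?thesis using assms by simp
qed

lemma vimage_None: "Z -` {None} \<inter> S = S - (\<Union>p. Z -` {Some p} \<inter> S)"
proof (rule set_eqI)
  show "\<omega> \<in> Z -` {None} \<inter> S \<longleftrightarrow> \<omega> \<in> S - (\<Union>p. Z -` {Some p} \<inter> S)" for \<omega>
    by (cases "Z \<omega>") auto
qed

lemma measurable_sole_contact:
  assumes d: "\<And>p. p \<in> node_pairs n \<Longrightarrow> d p \<in> measurable M' (count_space UNIV)"
  shows "(\<lambda>\<omega>. sole_contact n (\<lambda>p. d p \<omega>)) \<in> measurable M' (count_space UNIV)"
proof -
  let ?Z = "\<lambda>\<omega>. sole_contact n (\<lambda>p. d p \<omega>)"
  have some: "?Z -` {Some p} \<inter> space M' \<in> sets M'" for p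
  proof -
    have eq: "?Z -` {Some p} \<inter> space M' = {\<omega> \<in> space M'. (\<forall>p'\<in>node_pairs n. d p' \<omega> = of_bool (p' = p)) \<and> p \<in> node_pairs n}"
      by (auto simp: sole_contact_eq_Some_iff)
    have single: "{\<omega> \<in> space M'. d p' \<omega> = of_bool (p' = p)} \<in> sets M'" if "p' \<in> node_pairs n" for p'
    proof -
      have "d p' -` {of_bool (p' = p)} \<inter> space M' \<in> sets M'" by (rule measurable_sets[OF d[OF that]]) simp
      also have "d p' -` {of_bool (p' = p)} \<inter> space M' = {\<omega> \<in> space M'. d p' \<omega> = of_bool (p' = p)}" by blast
      finally show ?thesis .
    qed
    have all: "{\<omega> \<in> space M'. \<forall>p'\<in>node_pairs n. d p' \<omega> = of_bool (p' = p)} \<in> sets M'"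
      by (rule sets.sets_Collect_finite_All[OF single finite_node_pairs])
    show ?thesis unfolding eq by (rule sets.sets_Collect_conj[OF sets.sets_Collect_const all])
  qed
  have "?Z -` {None} \<inter> space M' = space M' - (\<Union>p. ?Z -` {Some p} \<inter> space M')"
    by (rule vimage_None)
  moreover have "(\<Union>p. ?Z -` {Some p} \<inter> space M') \<in> sets M'" using some by (intro sets.countable_UN') auto
  ultimately have none: "?Z -` {None} \<inter> space M' \<in> sets M'" by auto
  have "?Z -` {z} \<inter> space M' \<in> sets M'" for z using some none by (cases z) auto
  then show ?thesis by (intro measurable_count_space_eq2_countable[THEN iffD2]) auto
qed

lemma measurable_run_contacts:
  assumes "\<And>j. j < k \<Longrightarrow> z j \<in> measurable M' (count_space UNIV)"
  shows "(\<lambda>\<omega>. run_contacts (\<lambda>j. z j \<omega>) x0 k) \<in> measurable M' (count_space UNIV)"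
  using assms
proof (induction k)
  case (Suc k)
  have "(\<lambda>\<omega>. (\<lambda>i \<omega>. apply_contact i (run_contacts (\<lambda>j. z j \<omega>) x0 k)) (z k \<omega>) \<omega>) \<in> measurable M' (count_space UNIV)"
  proof (rule measurable_compose_countable)
    show "(\<lambda>\<omega>. apply_contact i (run_contacts (\<lambda>j. z j \<omega>) x0 k)) \<in> measurable M' (count_space UNIV)" for i
      by (rule measurable_compose[OF Suc.IH]) (use Suc.prems in auto)
  qed (use Suc.prems in auto)
  then show ?case by simp
qed simp

lemma run_contacts_cong:
  "(\<And>j. j < k \<Longrightarrow> z j = z' j) \<Longrightarrow> run_contacts z x0 k = run_contacts z' x0 k"
  by (induction k) (simp_all split: option.split)

lemma run_contacts_invariant:
  assumes "P x0" and "\<And>p x. p \<in> A \<Longrightarrow> P x \<Longrightarrow> P (update_pair p x)"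
    and "\<And>j p. z j = Some p \<Longrightarrow> p \<in> A"
  shows "P (run_contacts z x0 k)"
  using assms by (induction k) (auto split: option.split)

context pairwise_contacts
begin

abbreviation pair_rate :: "nat \<times> nat \<Rightarrow> real" where
  "pair_rate p \<equiv> Q (fst p) (snd p)"

definition total_rate :: real where
  "total_rate = (\<Sum>p\<in>node_pairs n. pair_rate p)"

abbreviation paths :: "'a \<Rightarrow> nat \<times> nat \<Rightarrow> real \<Rightarrow> nat" where
  "paths \<omega> \<equiv> \<lambda>p t. N p t \<omega>"

abbreviation cell_event :: "real \<Rightarrow> nat \<Rightarrow> 'a \<Rightarrow> (nat \<times> nat) option" where
  "cell_event h k \<omega> \<equiv> sole_contact n (cell_contacts (paths \<omega>) h k)"

lemma poisson: "p \<in> node_pairs n \<Longrightarrow> poisson_process (pair_rate p) (N p)"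
  using contacts_poisson[of "fst p" "snd p"] by simp

lemma pair_rate_nonneg: "p \<in> node_pairs n \<Longrightarrow> 0 \<le> pair_rate p"
  by (rule rates_nonneg) (auto simp: node_pairs_def)

lemma total_rate_nonneg: "0 \<le> total_rate"
  unfolding total_rate_def by (intro sum_nonneg pair_rate_nonneg)

lemma indep_cell_contacts:
  assumes h: "0 \<le> h"
  shows "indep_vars (\<lambda>_. count_space UNIV) (\<lambda>(p, k) \<omega>. cell_contacts (paths \<omega>) h k p) (node_pairs n \<times> UNIV)"
proof -
  have "indep_vars (\<lambda>(p, k). count_space UNIV)
     (\<lambda>(p, k) \<omega>. (\<lambda>y. y (real (Suc k) * h) - y (real k * h) :: nat) (\<lambda>t\<in>{0..}. N p t \<omega>)) (Sigma (node_pairs n) (\<lambda>_. UNIV))"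
  proof (rule indep_vars_Sigma[OF contacts_indep])
    fix p assume p: "p \<in> node_pairs n"
    have "mono (\<lambda>k. real k * h)" using h by (intro monoI mult_right_mono) auto
    then have "indep_vars (\<lambda>_. count_space UNIV) (\<lambda>k \<omega>. N p (real (Suc k) * h) \<omega> - N p (real k * h) \<omega>) UNIV"
      using poisson[OF p, unfolded poisson_process_def, THEN conjunct2, THEN conjunct2, THEN conjunct2,
          rule_format, of "\<lambda>k. real k * h"] by simp
    then show "indep_vars (\<lambda>_. count_space UNIV)
       (\<lambda>k \<omega>. (\<lambda>y. y (real (Suc k) * h) - y (real k * h) :: nat) (\<lambda>t\<in>{0..}. N p t \<omega>)) UNIV"
      using h by (simp del: of_nat_Suc)
  next
    fix k :: nat
    have "0 \<le> real (Suc k) * h" "0 \<le> real k * h" using h by auto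
    then have [measurable]: "(\<lambda>y. y (real (Suc k) * h)) \<in> measurable (\<Pi>\<^sub>M t\<in>{0..}. count_space UNIV) (count_space UNIV)"
      "(\<lambda>y. y (real k * h)) \<in> measurable (\<Pi>\<^sub>M t\<in>{0..}. count_space UNIV) (count_space UNIV)"
      by (auto intro!: measurable_component_singleton simp del: of_nat_Suc)
    show "(\<lambda>y. y (real (Suc k) * h) - y (real k * h) :: nat) \<in> measurable (\<Pi>\<^sub>M t\<in>{0..}. count_space UNIV) (count_space UNIV)"
      by (rule measurable_diff_nat) fact+
  qed
  also have "?this \<longleftrightarrow> ?thesis"
    using h by (intro indep_vars_cong) (auto simp: cell_contacts_def)
  finally show ?thesis .
qed

lemma measurable_cell_contacts:
  assumes "0 \<le> h" "p \<in> node_pairs n"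
  shows "random_variable (count_space UNIV) (\<lambda>\<omega>. cell_contacts (paths \<omega>) h k p)"
  using indep_cell_contacts[OF assms(1)] assms(2) by (force simp: indep_vars_def2)

lemma measurable_cell_event:
  assumes "0 \<le> h"
  shows "random_variable (count_space UNIV) (cell_event h k)"
  using measurable_sole_contact[of n "\<lambda>p \<omega>. cell_contacts (paths \<omega>) h k p" M]
    measurable_cell_contacts[OF assms] by simp

lemma prob_cell_contacts:
  assumes h: "0 \<le> h"
  shows "prob {\<omega> \<in> space M. \<forall>p\<in>node_pairs n. cell_contacts (paths \<omega>) h k p = d p} =
    (\<Prod>p\<in>node_pairs n. exp (- (pair_rate p * h)) * (pair_rate p * h) ^ d p / fact (d p))"
proof (cases "node_pairs n = {}")
  case True
  then show ?thesis by (simp add: prob_space)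
next
  case False
  have one: "prob {\<omega> \<in> space M. cell_contacts (paths \<omega>) h k p = m} =
      exp (- (pair_rate p * h)) * (pair_rate p * h) ^ m / fact m" if "p \<in> node_pairs n" for p m
  proof -
    have "prob {\<omega> \<in> space M. N p (real (Suc k) * h) \<omega> - N p (real k * h) \<omega> = m} =
      exp (- (pair_rate p * (real (Suc k) * h - real k * h))) * (pair_rate p * (real (Suc k) * h - real k * h)) ^ m / fact m"
      using poisson[OF that] h unfolding poisson_process_def by (simp add: mult_right_mono)
    then show ?thesis by (simp add: cell_contacts_def algebra_simps)
  qed
  let ?X = "\<lambda>(p, k) \<omega>. cell_contacts (paths \<omega>) h k p"
  have "prob {\<omega> \<in> space M. \<forall>p\<in>node_pairs n. cell_contacts (paths \<omega>) h k p = d p} =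
    prob (\<Inter>x\<in>node_pairs n \<times> {k}. ?X x -` {d (fst x)} \<inter> space M)"
    using False by (intro arg_cong[of _ _ prob]) auto
  also have "\<dots> = (\<Prod>x\<in>node_pairs n \<times> {k}. prob (?X x -` {d (fst x)} \<inter> space M))"
    using False finite_node_pairs by (intro indep_varsD[OF indep_cell_contacts[OF h]]) auto
  also have "\<dots> = (\<Prod>p\<in>node_pairs n. prob (?X (p, k) -` {d p} \<inter> space M))"
    by (rule prod.reindex_bij_witness[of _ "\<lambda>p. (p, k)" fst]) auto
  also have "\<dots> = (\<Prod>p\<in>node_pairs n. exp (- (pair_rate p * h)) * (pair_rate p * h) ^ d p / fact (d p))"
  proof (rule prod.cong[OF refl])
    fix p assume p: "p \<in> node_pairs n"
    have "?X (p, k) -` {d p} \<inter> space M = {\<omega> \<in> space M. cell_contacts (paths \<omega>) h k p = d p}" by auto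
    then show "prob (?X (p, k) -` {d p} \<inter> space M) = exp (- (pair_rate p * h)) * (pair_rate p * h) ^ d p / fact (d p)"
      using one[OF p] by simp
  qed
  finally show ?thesis .
qed

lemma prob_cell_event_Some:
  assumes h: "0 \<le> h" and p: "p \<in> node_pairs n"
  shows "prob {\<omega> \<in> space M. cell_event h k \<omega> = Some p} = pair_rate p * h * exp (- (total_rate * h))"
proof -
  have "prob {\<omega> \<in> space M. cell_event h k \<omega> = Some p} =
    (\<Prod>q\<in>node_pairs n. exp (- (pair_rate q * h)) * (pair_rate q * h) ^ of_bool (q = p) / fact (of_bool (q = p)))"
    using p by (subst prob_cell_contacts[OF h, symmetric]) (simp add: sole_contact_eq_Some_iff)
  also have "\<dots> = (\<Prod>q\<in>node_pairs n. exp (- (pair_rate q * h)) * (if q = p then pair_rate q * h else 1))"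
    by (intro prod.cong) auto
  also have "\<dots> = exp (\<Sum>q\<in>node_pairs n. - (pair_rate q * h)) * (pair_rate p * h)"
    using p finite_node_pairs by (simp add: prod.distrib exp_sum prod.delta)
  also have "(\<Sum>q\<in>node_pairs n. - (pair_rate q * h)) = - (total_rate * h)"
    by (simp add: total_rate_def sum_distrib_right sum_negf)
  finally show ?thesis by (simp add: mult_ac)
qed

lemma prob_cell_event_None:
  assumes h: "0 \<le> h"
  shows "prob {\<omega> \<in> space M. cell_event h k \<omega> = None} = 1 - total_rate * h * exp (- (total_rate * h))"
proof -
  have [measurable]: "random_variable (count_space UNIV) (cell_event h k)" by (rule measurable_cell_event[OF h])
  have sets: "{\<omega> \<in> space M. cell_event h k \<omega> = Some p} \<in> events" for p by measurable
  have eq: "{\<omega> \<in> space M. cell_event h k \<omega> = None} = space M - (\<Union>p\<in>node_pairs n. {\<omega> \<in> space M. cell_event h k \<omega> = Some p})"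
  proof (intro set_eqI iffI)
    fix \<omega> assume "\<omega> \<in> space M - (\<Union>p\<in>node_pairs n. {\<omega> \<in> space M. cell_event h k \<omega> = Some p})"
    then show "\<omega> \<in> {\<omega> \<in> space M. cell_event h k \<omega> = None}"
      by (cases "cell_event h k \<omega>") (auto simp: sole_contact_eq_Some_iff)
  qed auto
  have "prob {\<omega> \<in> space M. cell_event h k \<omega> = None} = 1 - prob (\<Union>p\<in>node_pairs n. {\<omega> \<in> space M. cell_event h k \<omega> = Some p})"
    unfolding eq using sets finite_node_pairs by (intro prob_compl) auto
  also have "prob (\<Union>p\<in>node_pairs n. {\<omega> \<in> space M. cell_event h k \<omega> = Some p}) =
      (\<Sum>p\<in>node_pairs n. prob {\<omega> \<in> space M. cell_event h k \<omega> = Some p})"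
    using sets finite_node_pairs by (intro finite_measure_finite_Union) (auto simp: disjoint_family_on_def)
  also have "\<dots> = total_rate * h * exp (- (total_rate * h))"
    by (simp add: prob_cell_event_Some[OF h] total_rate_def sum_distrib_right)
  finally show ?thesis .
qed

text \<open>
  With \<open>x = total_rate * h\<close>, an empty cell has probability \<open>exp (- x)\<close> and a cell with a sole
  contact has probability \<open>x * exp (- x)\<close>. What remains is of second order by \<open>exp (- x) \<ge> 1 - x\<close>.
\<close>

lemma prob_crowded_cell:
  assumes h: "0 \<le> h"
  shows "prob {\<omega> \<in> space M. \<not> (\<Sum>p\<in>node_pairs n. cell_contacts (paths \<omega>) h k p) \<le> 1} \<le> (total_rate * h)\<^sup>2"
proof -
  define x where "x = total_rate * h"
  have x: "0 \<le> x" using h total_rate_nonneg by (simp add: x_def)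
  have [measurable]: "random_variable (count_space UNIV) (cell_event h k)" by (rule measurable_cell_event[OF h])
  let ?E = "{\<omega> \<in> space M. \<forall>p\<in>node_pairs n. cell_contacts (paths \<omega>) h k p = 0}"
  let ?S = "{\<omega> \<in> space M. cell_event h k \<omega> = None}"
  let ?C = "{\<omega> \<in> space M. \<not> (\<Sum>p\<in>node_pairs n. cell_contacts (paths \<omega>) h k p) \<le> 1}"
  have S: "?S \<in> events" by measurable
  have "{\<omega> \<in> space M. cell_contacts (paths \<omega>) h k p = 0} \<in> events" if "p \<in> node_pairs n" for p
  proof -
    have "(\<lambda>\<omega>. cell_contacts (paths \<omega>) h k p) -` {0} \<inter> space M \<in> events"
      by (rule measurable_sets[OF measurable_cell_contacts[OF h that]]) simp
    also have "(\<lambda>\<omega>. cell_contacts (paths \<omega>) h k p) -` {0} \<inter> space M = {\<omega> \<in> space M. cell_contacts (paths \<omega>) h k p = 0}" by blast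
    finally show ?thesis .
  qed
  then have E: "?E \<in> events" by (intro sets.sets_Collect_finite_All finite_node_pairs) auto
  have "?E \<subseteq> ?S"
  proof safe
    fix \<omega> assume "\<forall>p\<in>node_pairs n. cell_contacts (paths \<omega>) h k p = 0"
    then show "cell_event h k \<omega> = None"
      using sole_contact_eq_Some_iff[of n "cell_contacts (paths \<omega>) h k"] by (cases "cell_event h k \<omega>") auto
  qed
  have "?C \<subseteq> ?S - ?E"
  proof safe
    fix \<omega> assume big: "\<not> (\<Sum>p\<in>node_pairs n. cell_contacts (paths \<omega>) h k p) \<le> 1"
    show "cell_event h k \<omega> = None"
    proof (cases "cell_event h k \<omega>")
      case (Some p)
      then have "p \<in> node_pairs n" "\<And>q. q \<in> node_pairs n \<Longrightarrow> cell_contacts (paths \<omega>) h k q = of_bool (q = p)"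
        by (auto simp: sole_contact_eq_Some_iff)
      then have "(\<Sum>p\<in>node_pairs n. cell_contacts (paths \<omega>) h k p) = 1"
        using finite_node_pairs by (simp add: of_bool_def sum.delta)
      then show ?thesis using big by simp
    qed
  next
    fix \<omega> assume "\<not> (\<Sum>p\<in>node_pairs n. cell_contacts (paths \<omega>) h k p) \<le> 1"
      "\<forall>p\<in>node_pairs n. cell_contacts (paths \<omega>) h k p = 0"
    then show False by simp
  qed
  then have "prob ?C \<le> prob (?S - ?E)" using S E by (intro finite_measure_mono) auto
  also have "\<dots> = prob ?S - prob ?E" using S E \<open>?E \<subseteq> ?S\<close> by (intro finite_measure_Diff)
  also have "prob ?E = (\<Prod>p\<in>node_pairs n. exp (- (pair_rate p * h)))"
    using prob_cell_contacts[OF h, of k "\<lambda>_. 0"] by simp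
  also have "\<dots> = exp (- x)"
    by (simp add: exp_sum[OF finite_node_pairs, symmetric] x_def total_rate_def sum_distrib_right sum_negf)
  also have "prob ?S - exp (- x) = 1 - (1 + x) * exp (- x)"
    by (simp add: prob_cell_event_None[OF h] x_def algebra_simps)
  also have "\<dots> \<le> 1 - (1 + x) * (1 - x)"
    using x exp_ge_add_one_self[of "- x"] by (intro diff_left_mono mult_left_mono) auto
  also have "\<dots> = x\<^sup>2" by (simp add: power2_eq_square algebra_simps)
  finally show ?thesis by (simp add: x_def)
qed

text \<open>
  The counts of a cell form one block of the independent family of all counts.
\<close>

lemma indep_cell_events:
  assumes h: "0 \<le> h"
  shows "indep_vars (\<lambda>_. count_space UNIV) (cell_event h) UNIV"
proof -
  let ?X = "\<lambda>(p, k) \<omega>. cell_contacts (paths \<omega>) h k p"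
  have "indep_vars (\<lambda>k. PiM (node_pairs n \<times> {k}) (\<lambda>_. count_space UNIV))
      (\<lambda>k \<omega>. restrict (\<lambda>x. ?X x \<omega>) (node_pairs n \<times> {k})) (UNIV :: nat set)"
    by (rule indep_vars_restrict[OF indep_cell_contacts[OF h]]) (auto simp: disjoint_family_on_def)
  then have "indep_vars (\<lambda>_. count_space UNIV)
      (\<lambda>k \<omega>. (\<lambda>k y. sole_contact n (\<lambda>p. y (p, k))) k (restrict (\<lambda>x. ?X x \<omega>) (node_pairs n \<times> {k}))) (UNIV :: nat set)"
    by (rule indep_vars_compose2)
       (auto intro!: measurable_sole_contact measurable_component_singleton)
  moreover have "sole_contact n (\<lambda>p. restrict (\<lambda>x. ?X x \<omega>) (node_pairs n \<times> {k}) (p, k)) = cell_event h k \<omega>" for k \<omega>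
  proof -
    have "sole_contact n (\<lambda>p. restrict (\<lambda>x. ?X x \<omega>) (node_pairs n \<times> {k}) (p, k)) = Some p \<longleftrightarrow> cell_event h k \<omega> = Some p" for p
      by (simp add: sole_contact_eq_Some_iff)
    then show ?thesis by (metis not_None_eq)
  qed
  ultimately show ?thesis by simp
qed

end

section \<open>The drift criterion on the grid\<close>

context pairwise_contacts
begin

lemma measurable_grid_state:
  "0 \<le> h \<Longrightarrow> random_variable (count_space UNIV) (\<lambda>\<omega>. grid_state n x0 (paths \<omega>) h k)"
  by (intro measurable_run_contacts measurable_cell_event)

lemma measurable_state_event:
  assumes "0 \<le> h"
  shows "{\<omega> \<in> space M. B (grid_state n x0 (paths \<omega>) h k)} \<in> events"
proof -
  have "(\<lambda>\<omega>. grid_state n x0 (paths \<omega>) h k) -` {x. B x} \<inter> space M \<in> events"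
    by (rule measurable_sets[OF measurable_grid_state[OF assms]]) simp
  also have "(\<lambda>\<omega>. grid_state n x0 (paths \<omega>) h k) -` {x. B x} \<inter> space M =
      {\<omega> \<in> space M. B (grid_state n x0 (paths \<omega>) h k)}" by blast
  finally show ?thesis .
qed

text \<open>
  The state at grid point \<open>k\<close> is a function of the outcomes of the earlier cells only.
\<close>

lemma indep_grid_state_cell_event:
  fixes g :: "(nat \<Rightarrow> node_state) \<Rightarrow> real" and f :: "(nat \<times> nat) option \<Rightarrow> real"
  assumes h: "0 \<le> h"
  shows "indep_var borel (\<lambda>\<omega>. g (grid_state n x0 (paths \<omega>) h k)) borel (\<lambda>\<omega>. f (cell_event h k \<omega>))"
proof -
  have "indep_var (PiM {..<k} (\<lambda>_. count_space UNIV)) (\<lambda>\<omega>. restrict (\<lambda>j. cell_event h j \<omega>) {..<k})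
     (PiM {k} (\<lambda>_. count_space UNIV)) (\<lambda>\<omega>. restrict (\<lambda>j. cell_event h j \<omega>) {k})"
    by (rule indep_var_restrict[OF indep_cell_events[OF h]]) auto
  then have "indep_var borel ((\<lambda>z. g (run_contacts (\<lambda>j. z j) x0 k)) \<circ> (\<lambda>\<omega>. restrict (\<lambda>j. cell_event h j \<omega>) {..<k}))
     borel ((\<lambda>z. f (z k)) \<circ> (\<lambda>\<omega>. restrict (\<lambda>j. cell_event h j \<omega>) {k}))"
    by (rule indep_var_compose)
      (auto intro!: measurable_compose[OF measurable_run_contacts] measurable_compose[OF measurable_component_singleton])
  moreover have "run_contacts (restrict (\<lambda>j. cell_event h j \<omega>) {..<k}) x0 k = grid_state n x0 (paths \<omega>) h k" for \<omega>
    by (rule run_contacts_cong) simp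
  ultimately show ?thesis by (simp add: comp_def)
qed

text \<open>
  One step of the chain: the outcome of the next cell is independent of the present state, and each
  pair is its sole contact with probability rate times \<open>h * exp (- (total_rate * h))\<close>.
\<close>

lemma expectation_next_grid_state:
  fixes g :: "(nat \<Rightarrow> node_state) \<Rightarrow> real"
  assumes h: "0 \<le> h" and bound: "\<And>\<omega> z. \<bar>g (apply_contact z (grid_state n x0 (paths \<omega>) h k))\<bar> \<le> D"
  defines "X \<equiv> \<lambda>\<omega>. grid_state n x0 (paths \<omega>) h k"
  shows "expectation (\<lambda>\<omega>. g (grid_state n x0 (paths \<omega>) h (Suc k))) = expectation (\<lambda>\<omega>. g (X \<omega>)) +
    h * exp (- (total_rate * h)) * expectation (\<lambda>\<omega>. \<Sum>p\<in>node_pairs n. pair_rate p * (g (update_pair p (X \<omega>)) - g (X \<omega>)))"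
proof -
  have X[measurable]: "random_variable (count_space UNIV) X" unfolding X_def by (rule measurable_grid_state[OF h])
  have [measurable]: "random_variable (count_space UNIV) (cell_event h k)" by (rule measurable_cell_event[OF h])
  have int: "integrable M (\<lambda>\<omega>. g (apply_contact z (X \<omega>)))" for z
  proof (rule integrable_const_bound[of _ D])
    show "random_variable borel (\<lambda>\<omega>. g (apply_contact z (X \<omega>)))"
      by (rule measurable_compose[OF X]) simp
    have "\<bar>g (apply_contact z (X \<omega>))\<bar> \<le> D" for \<omega> unfolding X_def by (rule bound)
    then show "AE \<omega> in M. norm (g (apply_contact z (X \<omega>))) \<le> D" by (intro AE_I2) (simp only: real_norm_def)
  qed
  let ?Z = "insert None (Some ` node_pairs n)"
  let ?I = "\<lambda>z \<omega>. of_bool (cell_event h k \<omega> = z) :: real"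
  have intI: "integrable M (?I z)" for z
    by (rule integrable_const_bound[of _ 1]) auto
  have EI: "expectation (?I z) = prob {\<omega> \<in> space M. cell_event h k \<omega> = z}" for z
    by (rule expectation_of_bool) measurable
  have indep: "indep_var borel (\<lambda>\<omega>. g (apply_contact z (X \<omega>))) borel (?I z)" for z
    unfolding X_def using indep_grid_state_cell_event[OF h, of "\<lambda>x. g (apply_contact z x)" x0 k "\<lambda>y. of_bool (y = z)"] .
  have Z: "cell_event h k \<omega> \<in> ?Z" for \<omega>
  proof (cases "cell_event h k \<omega>")
    case (Some p)
    then have "p \<in> node_pairs n" unfolding sole_contact_eq_Some_iff by (rule conjunct1)
    then show ?thesis unfolding Some by simp
  qed simp
  have split: "g (grid_state n x0 (paths \<omega>) h (Suc k)) = (\<Sum>z\<in>?Z. g (apply_contact z (X \<omega>)) * ?I z \<omega>)" for \<omega>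
  proof -
    have "(\<Sum>z\<in>?Z. g (apply_contact z (X \<omega>)) * ?I z \<omega>) = (\<Sum>z\<in>{cell_event h k \<omega>}. g (apply_contact z (X \<omega>)) * ?I z \<omega>)"
      by (rule sum.mono_neutral_right) (use Z finite_node_pairs in auto)
    then show ?thesis by (simp add: X_def split: option.split)
  qed
  have "expectation (\<lambda>\<omega>. g (grid_state n x0 (paths \<omega>) h (Suc k))) =
      (\<Sum>z\<in>?Z. expectation (\<lambda>\<omega>. g (apply_contact z (X \<omega>)) * ?I z \<omega>))"
    unfolding split by (intro Bochner_Integration.integral_sum indep_var_integrable[OF indep int intI])
  also have "\<dots> = (\<Sum>z\<in>?Z. expectation (\<lambda>\<omega>. g (apply_contact z (X \<omega>))) * prob {\<omega> \<in> space M. cell_event h k \<omega> = z})"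
    unfolding indep_var_lebesgue_integral[OF indep int intI] EI ..
  also have "\<dots> = expectation (\<lambda>\<omega>. g (X \<omega>)) * (1 - total_rate * h * exp (- (total_rate * h))) +
      (\<Sum>p\<in>node_pairs n. expectation (\<lambda>\<omega>. g (update_pair p (X \<omega>))) * (pair_rate p * h * exp (- (total_rate * h))))"
    using finite_node_pairs by (simp add: sum.reindex prob_cell_event_None[OF h] prob_cell_event_Some[OF h])
  also have "\<dots> = expectation (\<lambda>\<omega>. g (X \<omega>)) + h * exp (- (total_rate * h)) *
      (\<Sum>p\<in>node_pairs n. pair_rate p * (expectation (\<lambda>\<omega>. g (update_pair p (X \<omega>))) - expectation (\<lambda>\<omega>. g (X \<omega>))))"
  proof -
    have diff: "(\<Sum>p\<in>node_pairs n. pair_rate p * (expectation (\<lambda>\<omega>. g (update_pair p (X \<omega>))) - expectation (\<lambda>\<omega>. g (X \<omega>)))) =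
      (\<Sum>p\<in>node_pairs n. pair_rate p * expectation (\<lambda>\<omega>. g (update_pair p (X \<omega>)))) - total_rate * expectation (\<lambda>\<omega>. g (X \<omega>))"
      by (simp add: right_diff_distrib sum_subtractf total_rate_def sum_distrib_right)
    have weighted: "(\<Sum>p\<in>node_pairs n. expectation (\<lambda>\<omega>. g (update_pair p (X \<omega>))) * (pair_rate p * h * exp (- (total_rate * h)))) =
       h * exp (- (total_rate * h)) * (\<Sum>p\<in>node_pairs n. pair_rate p * expectation (\<lambda>\<omega>. g (update_pair p (X \<omega>))))"
      by (simp add: sum_distrib_left mult_ac)
    show ?thesis unfolding diff weighted by (simp add: algebra_simps)
  qed
  also have "(\<Sum>p\<in>node_pairs n. pair_rate p * (expectation (\<lambda>\<omega>. g (update_pair p (X \<omega>))) - expectation (\<lambda>\<omega>. g (X \<omega>)))) =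
      expectation (\<lambda>\<omega>. \<Sum>p\<in>node_pairs n. pair_rate p * (g (update_pair p (X \<omega>)) - g (X \<omega>)))"
    using int[of None] int[of "Some _"] by simp
  finally show ?thesis .
qed

text \<open>
  Each step lowers the expected potential by at least \<open>h * exp (- (total_rate * h))\<close> times the
  probability that the chain is in \<open>B\<close>, and the potential never becomes negative. Its initial value thus pays
  for all steps spent in \<open>B\<close>. The predicate \<open>I\<close> restricts all conditions to an invariant set of configurations.
\<close>

lemma expected_grid_occupation:
  fixes g :: "(nat \<Rightarrow> node_state) \<Rightarrow> real"
  assumes h: "0 \<le> h" and x0: "I x0"
    and inv: "\<And>p x. p \<in> node_pairs n \<Longrightarrow> I x \<Longrightarrow> I (update_pair p x)"
    and bound: "\<And>x. I x \<Longrightarrow> 0 \<le> g x \<and> g x \<le> D"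
    and drift: "\<And>x. I x \<Longrightarrow> (\<Sum>p\<in>node_pairs n. pair_rate p * (g (update_pair p x) - g x)) \<le> - of_bool (B x)"
  shows "h * exp (- (total_rate * h)) * (\<Sum>k<K. prob {\<omega> \<in> space M. B (grid_state n x0 (paths \<omega>) h k)}) \<le> g x0"
proof -
  let ?X = "\<lambda>k \<omega>. grid_state n x0 (paths \<omega>) h k"
  let ?e = "h * exp (- (total_rate * h))"
  have X[measurable]: "random_variable (count_space UNIV) (?X k)" for k by (rule measurable_grid_state[OF h])
  have IX: "I (?X k \<omega>)" for k \<omega>
    using x0 inv by (rule run_contacts_invariant) (auto simp: sole_contact_eq_Some_iff)
  have gnn: "0 \<le> expectation (\<lambda>\<omega>. g (?X k \<omega>))" for k
    using bound IX by (intro Bochner_Integration.integral_nonneg) blast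
  have "expectation (\<lambda>\<omega>. g (?X K \<omega>)) + ?e * (\<Sum>k<K. prob {\<omega> \<in> space M. B (?X k \<omega>)}) \<le> g x0"
  proof (induction K)
    case 0
    then show ?case by (simp add: prob_space)
  next
    case (Suc k)
    \<comment> \<open>Nothing bounds \<open>g\<close> outside \<open>I\<close>; the cut-off is invisible to the chain.\<close>
    let ?g = "\<lambda>x. if I x then g x else 0"
    have D: "0 \<le> D" using bound[OF x0] by linarith
    have next_step: "expectation (\<lambda>\<omega>. ?g (?X (Suc k) \<omega>)) = expectation (\<lambda>\<omega>. ?g (?X k \<omega>)) +
      ?e * expectation (\<lambda>\<omega>. \<Sum>p\<in>node_pairs n. pair_rate p * (?g (update_pair p (?X k \<omega>)) - ?g (?X k \<omega>)))"
      by (rule expectation_next_grid_state[OF h, of _ _ _ D]) (use bound D in auto)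
    have drop: "(\<lambda>\<omega>. \<Sum>p\<in>node_pairs n. pair_rate p * (?g (update_pair p (?X k \<omega>)) - ?g (?X k \<omega>))) =
       (\<lambda>\<omega>. \<Sum>p\<in>node_pairs n. pair_rate p * (g (update_pair p (?X k \<omega>)) - g (?X k \<omega>)))"
      using IX inv by (auto intro!: sum.cong)
    have "expectation (\<lambda>\<omega>. \<Sum>p\<in>node_pairs n. pair_rate p * (g (update_pair p (?X k \<omega>)) - g (?X k \<omega>)))
        \<le> expectation (\<lambda>\<omega>. - of_bool (B (?X k \<omega>)))"
    proof (rule integral_mono)
      let ?f = "\<lambda>x. \<Sum>p\<in>node_pairs n. pair_rate p * (g (update_pair p x) - g x)"
      have "random_variable borel (\<lambda>\<omega>. ?f (?X k \<omega>))" by (rule measurable_compose[OF X]) simp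
      moreover have "\<bar>?f (?X k \<omega>)\<bar> \<le> (\<Sum>p\<in>node_pairs n. \<bar>pair_rate p\<bar> * (2 * D))" for \<omega>
      proof (rule order_trans[OF sum_abs sum_mono])
        fix p assume "p \<in> node_pairs n"
        then have "\<bar>g (update_pair p (?X k \<omega>)) - g (?X k \<omega>)\<bar> \<le> 2 * D"
          using bound[OF IX, of \<omega> k] bound[OF inv[OF _ IX], of p \<omega> k] by linarith
        then show "\<bar>pair_rate p * (g (update_pair p (?X k \<omega>)) - g (?X k \<omega>))\<bar> \<le> \<bar>pair_rate p\<bar> * (2 * D)"
          unfolding abs_mult by (intro mult_left_mono) auto
      qed
      ultimately show "integrable M (\<lambda>\<omega>. ?f (?X k \<omega>))"
        by (intro integrable_const_bound[of _ "\<Sum>p\<in>node_pairs n. \<bar>pair_rate p\<bar> * (2 * D)"]) auto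
      have "random_variable borel (\<lambda>\<omega>. - of_bool (B (?X k \<omega>)) :: real)" by (rule measurable_compose[OF X]) simp
      then show "integrable M (\<lambda>\<omega>. - of_bool (B (?X k \<omega>)) :: real)"
        by (intro integrable_const_bound[of _ 1]) auto
    qed (rule drift[OF IX])
    also have "expectation (\<lambda>\<omega>. - of_bool (B (?X k \<omega>))) = - prob {\<omega> \<in> space M. B (?X k \<omega>)}"
      unfolding Bochner_Integration.integral_minus
      by (rule arg_cong[where f = uminus, OF expectation_of_bool[OF measurable_state_event[OF h, of B x0 k]]])
    finally have decrease: "expectation (\<lambda>\<omega>. \<Sum>p\<in>node_pairs n. pair_rate p * (g (update_pair p (?X k \<omega>)) - g (?X k \<omega>)))
        \<le> - prob {\<omega> \<in> space M. B (?X k \<omega>)}" .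
    have "expectation (\<lambda>\<omega>. ?g (?X (Suc k) \<omega>)) \<le> expectation (\<lambda>\<omega>. ?g (?X k \<omega>)) + ?e * - prob {\<omega> \<in> space M. B (?X k \<omega>)}"
      unfolding next_step drop by (intro add_left_mono mult_left_mono decrease mult_nonneg_nonneg h exp_ge_zero)
    then have "expectation (\<lambda>\<omega>. g (?X (Suc k) \<omega>)) \<le> expectation (\<lambda>\<omega>. g (?X k \<omega>)) + ?e * - prob {\<omega> \<in> space M. B (?X k \<omega>)}"
      by (simp only: IX if_True)
    then show ?case using Suc.IH unfolding sum.lessThan_Suc distrib_left by linarith
  qed
  then show ?thesis using gnn[of K] by linarith
qed

end

section \<open>From the grid to continuous time\<close>

text \<open>
  Durations are only determined almost surely by measurable functions, whence the completion.
\<close>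

lemma borel_measurable_completion_AE_eq:
  fixes f g :: "'b \<Rightarrow> ennreal"
  assumes f: "f \<in> borel_measurable (completion M)" and ae: "AE x in M. f x = g x"
  shows "g \<in> borel_measurable (completion M)"
proof (rule measurableI)
  fix A :: "ennreal set" assume A: "A \<in> sets borel"
  show "g -` A \<inter> space (completion M) \<in> sets (completion M)"
  proof (rule completion.in_sets_AE)
    have "AE x in completion M. f x = g x \<and> x \<in> space (completion M)"
      using AE_completion[OF ae] by (intro AE_conjI AE_space)
    then show "AE x in completion M. x \<in> f -` A \<inter> space (completion M) \<longleftrightarrow> x \<in> g -` A \<inter> space (completion M)"
      by eventually_elim auto
    show "f -` A \<inter> space (completion M) \<in> sets (completion M)" using f A by (rule measurable_sets)
  qed simp
qed simp

text \<open>
  A sojourn of length \<open>D\<close> that starts at a finite time \<open>S\<close> is exhausted by its parts before the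
  horizons \<open>R\<close>. The truncated subtraction makes the part \<open>0\<close> if \<open>R\<close> comes before \<open>S\<close>.
\<close>

lemma ennreal_min_residual_SUP:
  fixes D S :: ennreal
  assumes "S < top"
  shows "D = (SUP R::nat. min D (ennreal (real R) - S))"
proof (rule antisym)
  show "D \<le> (SUP R::nat. min D (ennreal (real R) - S))"
  proof (rule dense_le)
    fix y assume y: "y < D"
    obtain s where s: "S = ennreal s" "0 \<le> s" using assms by (cases S) auto
    obtain y' where y': "y = ennreal y'" "0 \<le> y'" using y by (cases y) auto
    obtain R :: nat where R: "s + y' \<le> real R" using real_arch_simple by blast
    have "y \<le> ennreal (real R) - S"
      using R s y' by (simp add: ennreal_minus)
    then have "y \<le> min D (ennreal (real R) - S)" using y by simp
    also have "\<dots> \<le> (SUP R::nat. min D (ennreal (real R) - S))" by (intro SUP_upper) simp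
    finally show "y \<le> (SUP R::nat. min D (ennreal (real R) - S))" .
  qed
  show "(SUP R::nat. min D (ennreal (real R) - S)) \<le> D" by (intro SUP_least) simp
qed

context pairwise_contacts
begin

lemma AE_counting_paths: "AE \<omega> in M. counting_paths n (paths \<omega>)"
proof -
  have "AE \<omega> in M. mono_on {0..} (\<lambda>t. N p t \<omega>) \<and> (\<forall>t\<ge>0. ((\<lambda>s. N p s \<omega>) \<longlongrightarrow> N p t \<omega>) (at_right t))"
    if "p \<in> node_pairs n" for p
    using poisson[OF that] unfolding poisson_process_def by auto
  then have "AE \<omega> in M. \<forall>p\<in>node_pairs n. mono_on {0..} (\<lambda>t. N p t \<omega>) \<and>
      (\<forall>t\<ge>0. ((\<lambda>s. N p s \<omega>) \<longlongrightarrow> N p t \<omega>) (at_right t))"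
    using finite_node_pairs by (intro AE_finite_allI)
  then show ?thesis unfolding counting_paths_def .
qed

lemma measurable_crowded_cell:
  assumes h: "0 \<le> h"
  shows "{\<omega> \<in> space M. \<not> (\<Sum>p\<in>node_pairs n. cell_contacts (paths \<omega>) h k p) \<le> 1} \<in> events"
proof -
  have [measurable]: "random_variable borel (\<lambda>\<omega>. real (cell_contacts (paths \<omega>) h k p))" if "p \<in> node_pairs n" for p
    by (rule measurable_compose[OF measurable_cell_contacts[OF h that]]) simp
  have "{\<omega> \<in> space M. \<not> (\<Sum>p\<in>node_pairs n. real (cell_contacts (paths \<omega>) h k p)) \<le> 1} \<in> events"
    by measurable
  also have "{\<omega> \<in> space M. \<not> (\<Sum>p\<in>node_pairs n. real (cell_contacts (paths \<omega>) h k p)) \<le> 1} =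
    {\<omega> \<in> space M. \<not> (\<Sum>p\<in>node_pairs n. cell_contacts (paths \<omega>) h k p) \<le> 1}"
  proof -
    have "(\<Sum>p\<in>node_pairs n. real (cell_contacts (paths \<omega>) h k p)) \<le> 1 \<longleftrightarrow>
        (\<Sum>p\<in>node_pairs n. cell_contacts (paths \<omega>) h k p) \<le> 1" for \<omega>
      unfolding of_nat_sum[symmetric] using of_nat_le_iff[of _ 1, where ?'a = real] by (simp only: of_nat_1)
    then show ?thesis by (simp only:)
  qed
  finally show ?thesis .
qed

lemma bad_grid_eq: "{\<omega> \<in> space M. \<not> good_grid n (paths \<omega>) h K} =
   (\<Union>k\<in>{..<K}. {\<omega> \<in> space M. \<not> (\<Sum>p\<in>node_pairs n. cell_contacts (paths \<omega>) h k p) \<le> 1})"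
  unfolding good_grid_def by blast

lemma measurable_bad_grid: "0 \<le> h \<Longrightarrow> {\<omega> \<in> space M. \<not> good_grid n (paths \<omega>) h K} \<in> events"
  unfolding bad_grid_eq by (intro sets.finite_UN measurable_crowded_cell) simp_all

lemma measurable_good_grid:
  assumes "0 \<le> h" shows "{\<omega> \<in> space M. good_grid n (paths \<omega>) h K} \<in> events"
proof -
  have "{\<omega> \<in> space M. good_grid n (paths \<omega>) h K} = space M - {\<omega> \<in> space M. \<not> good_grid n (paths \<omega>) h K}" by blast
  then show ?thesis using measurable_bad_grid[OF assms, of K] by simp
qed

text \<open>
  Union bound over the \<open>K\<close> cells: the bound is of second order in the cell length, so it vanishes as
  the grid is refined.
\<close>

lemma prob_bad_grid:
  assumes t: "0 \<le> t" and K: "0 < K"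
  shows "prob {\<omega> \<in> space M. \<not> good_grid n (paths \<omega>) (t / real K) K} \<le> (total_rate * t)\<^sup>2 / real K"
proof -
  have h: "0 \<le> t / real K" using t by simp
  have "prob {\<omega> \<in> space M. \<not> good_grid n (paths \<omega>) (t / real K) K} \<le>
      (\<Sum>k<K. prob {\<omega> \<in> space M. \<not> (\<Sum>p\<in>node_pairs n. cell_contacts (paths \<omega>) (t / real K) k p) \<le> 1})"
    unfolding bad_grid_eq using measurable_crowded_cell[OF h] by (intro finite_measure_subadditive_finite) blast+
  also have "\<dots> \<le> (\<Sum>k<K. (total_rate * (t / real K))\<^sup>2)"
    by (intro sum_mono prob_crowded_cell[OF h])
  also have "\<dots> = (total_rate * t)\<^sup>2 / real K"
    using K by (simp add: power2_eq_square field_simps)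
  finally show ?thesis .
qed

text \<open>
  Since the bound for a single grid tends to zero, almost surely not all grids can be bad.
\<close>

lemma AE_good_grid:
  assumes t: "0 \<le> t"
  shows "AE \<omega> in M. \<exists>K>0. good_grid n (paths \<omega>) (t / real K) K"
proof -
  let ?S = "{\<omega> \<in> space M. \<forall>K. 0 < K \<longrightarrow> \<not> good_grid n (paths \<omega>) (t / real K) K}"
  have "{\<omega> \<in> space M. 0 < K \<longrightarrow> \<not> good_grid n (paths \<omega>) (t / real K) K} \<in> events" for K
    by (intro sets.sets_Collect_imp measurable_bad_grid sets.sets_Collect_const) (use t in simp)
  then have S: "?S \<in> events" by (rule sets.sets_Collect_countable_All)
  have "prob ?S \<le> (total_rate * t)\<^sup>2 / real K" if "0 < K" for K
  proof -
    have "prob ?S \<le> prob {\<omega> \<in> space M. \<not> good_grid n (paths \<omega>) (t / real K) K}"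
      using measurable_bad_grid t that by (intro finite_measure_mono) auto
    then show ?thesis using prob_bad_grid[OF t that] by simp
  qed
  then have "eventually (\<lambda>K. prob ?S \<le> (total_rate * t)\<^sup>2 / real K) sequentially"
    by (intro eventually_mono[OF eventually_gt_at_top[of 0]])
  moreover have "(\<lambda>K. (total_rate * t)\<^sup>2 / real K) \<longlonglongrightarrow> 0" by (rule lim_const_over_n)
  ultimately have "prob ?S \<le> 0" by (intro tendsto_lowerbound[of _ 0 sequentially]) auto
  then have "prob ?S = 0" using measure_nonneg[of M ?S] by linarith
  have null: "A \<in> null_sets M" if "A \<in> events" "prob A = 0" for A
    using that by (simp add: emeasure_eq_measure null_sets_def)
  have "?S \<in> null_sets M" using S \<open>prob ?S = 0\<close> by (rule null)
  then show ?thesis by (rule AE_I') blast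
qed

lemma AE_regular_paths: "AE \<omega> in M. regular_paths n (paths \<omega>)"
proof -
  have "AE \<omega> in M. \<forall>r\<in>\<rat> \<inter> {0..}. \<exists>K>0. good_grid n (paths \<omega>) (r / real K) K"
    by (subst AE_ball_countable) (auto intro: AE_good_grid countable_Int1 countable_rat)
  with AE_counting_paths show ?thesis
    by eventually_elim (auto simp: regular_paths_def)
qed

text \<open>
  Up to a null set, the configuration at a rational time is read off from any good grid that ends
  there.
\<close>

lemma measurable_consensus_event:
  assumes r: "r \<in> \<rat>" "0 \<le> r"
  shows "{\<omega> \<in> space M. B (consensus_state n x0 (paths \<omega>) r)} \<in> sets (completion M)"
proof (rule completion.in_sets_AE)
  let ?E = "{\<omega> \<in> space M. \<exists>K. 0 < K \<and> good_grid n (paths \<omega>) (r / real K) K \<and> B (grid_state n x0 (paths \<omega>) (r / real K) K)}"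
  have "{\<omega> \<in> space M. 0 < K \<and> good_grid n (paths \<omega>) (r / real K) K \<and> B (grid_state n x0 (paths \<omega>) (r / real K) K)} \<in> events" for K
    by (intro sets.sets_Collect_conj sets.sets_Collect_const measurable_good_grid measurable_state_event) (use r in simp_all)
  then have "?E \<in> events" by (rule sets.sets_Collect_countable_Ex)
  then show "?E \<in> sets (completion M)" by (rule sets_completionI_sets)
  have "AE \<omega> in M. \<omega> \<in> ?E \<longleftrightarrow> \<omega> \<in> {\<omega> \<in> space M. B (consensus_state n x0 (paths \<omega>) r)}"
    using AE_regular_paths AE_space
  proof eventually_elim
    fix \<omega> assume reg: "regular_paths n (paths \<omega>)" and \<omega>: "\<omega> \<in> space M"
    have eq: "grid_state n x0 (paths \<omega>) (r / real K) K = consensus_state n x0 (paths \<omega>) r"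
      if "0 < K" "good_grid n (paths \<omega>) (r / real K) K" for K
      using good_grid_state[of n "paths \<omega>" "r / real K" K K x0] reg r that by (simp add: regular_paths_def)
    obtain K where "0 < K" "good_grid n (paths \<omega>) (r / real K) K"
      using reg r unfolding regular_paths_def by blast
    then show "\<omega> \<in> ?E \<longleftrightarrow> \<omega> \<in> {\<omega> \<in> space M. B (consensus_state n x0 (paths \<omega>) r)}"
      using eq \<omega> by (simp add: conj_commute cong: conj_cong) (metis (lifting) eq)
  qed
  then show "AE \<omega> in completion M. \<omega> \<in> ?E \<longleftrightarrow> \<omega> \<in> {\<omega> \<in> space M. B (consensus_state n x0 (paths \<omega>) r)}"
    by (rule AE_completion)
qed simp

lemma measurable_hitting_time:
  assumes B: "absorbing n B"
  shows "(\<lambda>\<omega>. hitting_time n x0 (paths \<omega>) B) \<in> borel_measurable (completion M)"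
proof (rule borel_measurable_completion_AE_eq)
  show "(\<lambda>\<omega>. INF r\<in>\<rat> \<inter> {0..}. if B (consensus_state n x0 (paths \<omega>) r) then ennreal r else top) \<in> borel_measurable (completion M)"
  proof (rule borel_measurable_INF)
    fix r :: real assume "r \<in> \<rat> \<inter> {0..}"
    then have "{\<omega> \<in> space (completion M). B (consensus_state n x0 (paths \<omega>) r)} \<in> sets (completion M)"
      using measurable_consensus_event[of r B x0] by simp
    then show "(\<lambda>\<omega>. if B (consensus_state n x0 (paths \<omega>) r) then ennreal r else top) \<in> borel_measurable (completion M)"
      by (intro measurable_If) simp_all
  qed (intro countable_Int1 countable_rat)
  show "AE \<omega> in M. (INF r\<in>\<rat> \<inter> {0..}. if B (consensus_state n x0 (paths \<omega>) r) then ennreal r else top) = hitting_time n x0 (paths \<omega>) B"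
    using AE_regular_paths
  proof eventually_elim
    fix \<omega> assume "regular_paths n (paths \<omega>)"
    then show "(INF r\<in>\<rat> \<inter> {0..}. if B (consensus_state n x0 (paths \<omega>) r) then ennreal r else top) = hitting_time n x0 (paths \<omega>) B"
      by (rule hitting_time_rational[OF _ B, symmetric])
  qed
qed

text \<open>
  On a good grid the sojourn is estimated by the grid points that it covers, which lie in \<open>B\<close>. On a bad
  grid the horizon itself is the bound.
\<close>

lemma truncated_sojourn_le:
  fixes R K :: nat
  assumes R: "0 < R" and K: "0 < K" and reg: "regular_paths n (paths \<omega>)"
    and S: "S < top"
    and inside: "\<And>t. 0 \<le> t \<Longrightarrow> S < ennreal t \<Longrightarrow> ennreal t < S + D \<Longrightarrow> B (consensus_state n x0 (paths \<omega>) t)"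
  defines "h \<equiv> real R / real K"
  shows "min D (ennreal (real R) - S) \<le>
    ennreal (h + h * (\<Sum>k<K. of_bool (B (grid_state n x0 (paths \<omega>) h k))) + real R * of_bool (\<not> good_grid n (paths \<omega>) h K))"
proof -
  have h: "0 < h" using R K by (simp add: h_def)
  obtain s where s: "S = ennreal s" "0 \<le> s" using S by (cases S) auto
  let ?sum = "\<Sum>k<K. of_bool (B (grid_state n x0 (paths \<omega>) h k)) :: real"
  have sum: "0 \<le> ?sum" by (intro sum_nonneg) simp
  show ?thesis
  proof (cases "s < real R")
    case False
    then show ?thesis using s by (simp add: ennreal_minus ennreal_neg)
  next
    case True
    show ?thesis
    proof (cases "good_grid n (paths \<omega>) h K")
      case False
      have "min D (ennreal (real R) - S) \<le> ennreal (real R - s)" using s by (simp add: ennreal_minus)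
      also have "\<dots> \<le> ennreal (h + h * ?sum + real R * of_bool (\<not> good_grid n (paths \<omega>) h K))"
      proof (rule ennreal_leI)
        have "0 \<le> h * ?sum" using h sum by simp
        moreover have "real R * of_bool (\<not> good_grid n (paths \<omega>) h K) = real R" using False by simp
        ultimately show "real R - s \<le> h + h * ?sum + real R * of_bool (\<not> good_grid n (paths \<omega>) h K)"
          using s(2) h by linarith
      qed
      finally show ?thesis .
    next
      case good: True
      define b where "b = (if D = top then real R else min (real R) (s + enn2real D))"
      have bR: "b \<le> real K * h" using K by (simp add: b_def h_def)
      have D_b: "ennreal b \<le> S + D \<and> min D (ennreal (real R) - S) = ennreal (b - s)"
      proof (cases D)
        case top
        then show ?thesis using s True by (simp add: b_def ennreal_minus)
      next
        case (real d)
        have b: "b = min (real R) (s + d)" using real by (simp add: b_def)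
        have "ennreal b \<le> ennreal (s + d)" unfolding b by (intro ennreal_leI) simp
        then have "ennreal b \<le> S + D" using s real by (simp add: ennreal_plus)
        moreover have "min (ennreal d) (ennreal (real R - s)) = ennreal (min d (real R - s))"
          using s real True by (simp add: min_def ennreal_le_iff)
        moreover have "min d (real R - s) = b - s" unfolding b by (simp add: min_def)
        ultimately show ?thesis using s real by (simp add: ennreal_minus)
      qed
      have "card {k. k < K \<and> s < real k * h \<and> real k * h < b} \<le> card {k. k < K \<and> B (grid_state n x0 (paths \<omega>) h k)}"
      proof (rule card_mono)
        show "{k. k < K \<and> s < real k * h \<and> real k * h < b} \<subseteq> {k. k < K \<and> B (grid_state n x0 (paths \<omega>) h k)}"
        proof safe
          fix k assume k: "k < K" "s < real k * h" "real k * h < b"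
          have "0 \<le> real k * h" using h by simp
          then have "ennreal (real k * h) < ennreal b" using k(3) by (simp add: ennreal_less_iff)
          then have "ennreal (real k * h) < S + D" using D_b by (auto intro: less_le_trans)
          moreover have "S < ennreal (real k * h)" using s k by (simp add: ennreal_less_iff)
          ultimately have "B (consensus_state n x0 (paths \<omega>) (real k * h))"
            using h by (intro inside) auto
          then show "B (grid_state n x0 (paths \<omega>) h k)"
            using good_grid_state[of n "paths \<omega>" h K k x0] reg good h k by (simp add: regular_paths_def)
        qed
      qed simp
      also have "real (card {k. k < K \<and> B (grid_state n x0 (paths \<omega>) h k)}) = ?sum"
        by (simp add: of_bool_def sum.If_cases Int_def lessThan_def)
      finally have "real (card {k. k < K \<and> s < real k * h \<and> real k * h < b}) \<le> ?sum" by simp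
      then have "h * real (card {k. k < K \<and> s < real k * h \<and> real k * h < b}) \<le> h * ?sum"
        using h by (intro mult_left_mono) auto
      then have "b - s \<le> h + h * ?sum"
        using many_grid_points_between[OF h s(2) bR] by linarith
      then show ?thesis using D_b good by (simp add: ennreal_leI)
    qed
  qed
qed

text \<open>
  The drift criterion in continuous time. The sojourn \<open>D\<close> may begin at an arbitrary random time \<open>S\<close>, since the
  occupation of \<open>B\<close> is counted from time \<open>0\<close>.
\<close>

lemma expected_sojourn_le:
  fixes g :: "(nat \<Rightarrow> node_state) \<Rightarrow> real"
  assumes S: "S \<in> borel_measurable (completion M)" and D: "D \<in> borel_measurable (completion M)"
    and S_fin: "AE \<omega> in M. S \<omega> < top"
    and inside: "\<And>\<omega> t. regular_paths n (paths \<omega>) \<Longrightarrow> 0 \<le> t \<Longrightarrow> S \<omega> < ennreal t \<Longrightarrow> ennreal t < S \<omega> + D \<omega> \<Longrightarrow>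
       B (consensus_state n x0 (paths \<omega>) t)"
    and x0: "I x0"
    and inv: "\<And>p x. p \<in> node_pairs n \<Longrightarrow> I x \<Longrightarrow> I (update_pair p x)"
    and bound: "\<And>x. I x \<Longrightarrow> 0 \<le> g x \<and> g x \<le> C"
    and drift: "\<And>x. I x \<Longrightarrow> (\<Sum>p\<in>node_pairs n. pair_rate p * (g (update_pair p x) - g x)) \<le> - of_bool (B x)"
  shows "(\<integral>\<^sup>+ \<omega>. D \<omega> \<partial>M) \<le> ennreal (g x0)"
proof -
  have trunc: "(\<integral>\<^sup>+ \<omega>. min (D \<omega>) (ennreal (real R) - S \<omega>) \<partial>M) \<le> ennreal (g x0)" if R: "0 < R" for R :: nat
  proof -
    \<comment> \<open>The three terms are the discretization error, the bound for the grid chain, and the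
      horizon times the probability of a bad grid.\<close>
    let ?err = "\<lambda>K. real R / real K + exp (total_rate * (real R / real K)) * g x0 + real R * ((total_rate * real R)\<^sup>2 / real K)"
    have "(\<integral>\<^sup>+ \<omega>. min (D \<omega>) (ennreal (real R) - S \<omega>) \<partial>M) \<le> ennreal (?err K)" if K: "0 < K" for K :: nat
    proof -
      define h where "h = real R / real K"
      have h: "0 < h" using R K by (simp add: h_def)
      let ?b = "\<lambda>k \<omega>. of_bool (B (grid_state n x0 (paths \<omega>) h k)) :: real"
      let ?g = "\<lambda>\<omega>. of_bool (\<not> good_grid n (paths \<omega>) h K) :: real"
      have mb[measurable]: "?b k \<in> borel_measurable M" for k
        by (rule measurable_compose[OF measurable_grid_state[of h]]) (use h in simp_all)
      have mg[measurable]: "?g \<in> borel_measurable M"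
        unfolding of_bool_def using measurable_bad_grid[of h K] h by (intro measurable_If) simp_all
      have ib: "integrable M (?b k)" for k by (rule integrable_const_bound[of _ 1]) auto
      have ig: "integrable M ?g" by (rule integrable_const_bound[of _ 1]) auto
      have "(\<integral>\<^sup>+ \<omega>. min (D \<omega>) (ennreal (real R) - S \<omega>) \<partial>M) \<le>
          (\<integral>\<^sup>+ \<omega>. ennreal (h + h * (\<Sum>k<K. ?b k \<omega>) + real R * ?g \<omega>) \<partial>M)"
      proof (rule nn_integral_mono_AE)
        show "AE \<omega> in M. min (D \<omega>) (ennreal (real R) - S \<omega>) \<le> ennreal (h + h * (\<Sum>k<K. ?b k \<omega>) + real R * ?g \<omega>)"
          using S_fin AE_regular_paths
        proof eventually_elim
          fix \<omega> assume "S \<omega> < top" and reg: "regular_paths n (paths \<omega>)"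
          then show "min (D \<omega>) (ennreal (real R) - S \<omega>) \<le> ennreal (h + h * (\<Sum>k<K. ?b k \<omega>) + real R * ?g \<omega>)"
            unfolding h_def by (intro truncated_sojourn_le[OF R K reg] inside[OF reg])
        qed
      qed
      also have "\<dots> = ennreal (expectation (\<lambda>\<omega>. h + h * (\<Sum>k<K. ?b k \<omega>) + real R * ?g \<omega>))"
              proof (rule nn_integral_eq_integral)
        show "integrable M (\<lambda>\<omega>. h + h * (\<Sum>k<K. ?b k \<omega>) + real R * ?g \<omega>)"
          by (intro Bochner_Integration.integrable_add integrable_const integrable_mult_right
              Bochner_Integration.integrable_sum ib ig)
        have "0 \<le> h + h * (\<Sum>k<K. ?b k \<omega>) + real R * ?g \<omega>" for \<omega>
          using h by (intro add_nonneg_nonneg mult_nonneg_nonneg sum_nonneg) simp_all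
        then show "AE \<omega> in M. 0 \<le> h + h * (\<Sum>k<K. ?b k \<omega>) + real R * ?g \<omega>" by (intro AE_I2)
      qed
      also have "expectation (\<lambda>\<omega>. h + h * (\<Sum>k<K. ?b k \<omega>) + real R * ?g \<omega>) =
          h + h * (\<Sum>k<K. expectation (?b k)) + real R * expectation ?g"
        using ib ig by (simp add: prob_space del: sum_of_bool_eq)
      also have "\<dots> \<le> ?err K"
      proof -
        have "expectation (?b k) = prob {\<omega> \<in> space M. B (grid_state n x0 (paths \<omega>) h k)}" for k
          by (rule expectation_of_bool[OF measurable_state_event]) (use h in simp)
        moreover have "h * exp (- (total_rate * h)) * (\<Sum>k<K. prob {\<omega> \<in> space M. B (grid_state n x0 (paths \<omega>) h k)}) \<le> g x0"
          by (rule expected_grid_occupation[where I = I]) (use h x0 inv bound drift in auto)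
        ultimately have "exp (- (total_rate * h)) * (h * (\<Sum>k<K. expectation (?b k))) \<le> g x0" by (simp add: mult_ac)
        then have "exp (total_rate * h) * (exp (- (total_rate * h)) * (h * (\<Sum>k<K. expectation (?b k)))) \<le> exp (total_rate * h) * g x0"
          by (intro mult_left_mono) auto
        then have occ: "h * (\<Sum>k<K. expectation (?b k)) \<le> exp (total_rate * h) * g x0"
          by (simp add: mult.assoc[symmetric] exp_minus)
        have "expectation ?g = prob {\<omega> \<in> space M. \<not> good_grid n (paths \<omega>) h K}"
          by (rule expectation_of_bool[OF measurable_bad_grid]) (use h in simp)
        also have "\<dots> \<le> (total_rate * real R)\<^sup>2 / real K"
          unfolding h_def using K by (intro prob_bad_grid) auto
        finally have "real R * expectation ?g \<le> real R * ((total_rate * real R)\<^sup>2 / real K)"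
          by (intro mult_left_mono) auto
        then show ?thesis using occ unfolding h_def by linarith
      qed
      finally show ?thesis by (simp add: ennreal_leI)
    qed
    then have "eventually (\<lambda>K. (\<integral>\<^sup>+ \<omega>. min (D \<omega>) (ennreal (real R) - S \<omega>) \<partial>M) \<le> ennreal (?err K)) sequentially"
      by (intro eventually_mono[OF eventually_gt_at_top[of 0]])
    moreover have "(\<lambda>K. ennreal (?err K)) \<longlonglongrightarrow> ennreal (g x0)"
    proof (rule tendsto_ennrealI)
      have "?err \<longlonglongrightarrow> 0 + exp (total_rate * 0) * g x0 + real R * 0"
        by (intro tendsto_intros lim_const_over_n)
      then show "?err \<longlonglongrightarrow> g x0" by simp
    qed
    ultimately show ?thesis by (intro tendsto_lowerbound[of _ _ sequentially]) auto
  qed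
  have "(\<integral>\<^sup>+ \<omega>. D \<omega> \<partial>M) = (\<integral>\<^sup>+ \<omega>. D \<omega> \<partial>completion M)" by (simp add: nn_integral_completion)
  also have "\<dots> = (\<integral>\<^sup>+ \<omega>. (SUP R::nat. min (D \<omega>) (ennreal (real R) - S \<omega>)) \<partial>completion M)"
  proof (rule nn_integral_cong_AE)
    show "AE \<omega> in completion M. D \<omega> = (SUP R::nat. min (D \<omega>) (ennreal (real R) - S \<omega>))"
      using AE_completion[OF S_fin]
    proof eventually_elim
      fix \<omega> assume "S \<omega> < top"
      then show "D \<omega> = (SUP R::nat. min (D \<omega>) (ennreal (real R) - S \<omega>))" by (rule ennreal_min_residual_SUP)
    qed
  qed
  also have "\<dots> = (SUP R::nat. \<integral>\<^sup>+ \<omega>. min (D \<omega>) (ennreal (real R) - S \<omega>) \<partial>completion M)"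
  proof (rule nn_integral_monotone_convergence_SUP)
    show "incseq (\<lambda>R \<omega>. min (D \<omega>) (ennreal (real R) - S \<omega>))"
    proof (intro monoI le_funI)
      fix R R' :: nat and \<omega> assume "R \<le> R'"
      then have "ennreal (real R) - S \<omega> \<le> ennreal (real R') - S \<omega>"
        by (intro ennreal_minus_mono ennreal_leI order_refl) simp
      then show "min (D \<omega>) (ennreal (real R) - S \<omega>) \<le> min (D \<omega>) (ennreal (real R') - S \<omega>)"
        by (rule min.mono[OF order_refl])
    qed
    show "(\<lambda>\<omega>. min (D \<omega>) (ennreal (real R) - S \<omega>)) \<in> borel_measurable (completion M)" for R
      using S D by simp
  qed
  also have "\<dots> \<le> ennreal (g x0)"
  proof (rule SUP_least)
    fix R :: nat
    show "(\<integral>\<^sup>+ \<omega>. min (D \<omega>) (ennreal (real R) - S \<omega>) \<partial>completion M) \<le> ennreal (g x0)"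
      unfolding nn_integral_completion
    proof (cases "R = 0")
      case True
      then show "(\<integral>\<^sup>+ \<omega>. min (D \<omega>) (ennreal (real R) - S \<omega>) \<partial>M) \<le> ennreal (g x0)" by simp
    qed (use trunc in simp)
  qed
  finally show ?thesis .
qed

end

section \<open>A logarithmic potential on the star\<close>

text \<open>
  The derivative \<open>1 / (c * v)\<close> at \<open>v \<ge> \<theta>\<close> converts a decay of \<open>v\<close> at the relative rate \<open>c\<close> into one
  at the absolute rate \<open>1\<close>. It is used at \<open>v = 0\<close> and \<open>v \<ge> \<theta>\<close> only.
\<close>

definition relative_log :: "real \<Rightarrow> real \<Rightarrow> real \<Rightarrow> real" where
  "relative_log c \<theta> v = (if v = 0 then 0 else (ln (v / \<theta>) + 1) / c)"

text \<open>
  For \<open>b \<noteq> 0\<close> this is \<open>ln y \<le> y - 1\<close> at \<open>y = b / a\<close>. For \<open>b = 0\<close> the right-hand side is \<open>- 1 / c\<close>, and the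
  summand \<open>1 / c\<close> of the function makes room for it.
\<close>

lemma relative_log_tangent:
  assumes c: "0 < c" and \<theta>: "0 < \<theta>" and a: "\<theta> \<le> a" and b: "b = 0 \<or> \<theta> \<le> b"
  shows "relative_log c \<theta> b - relative_log c \<theta> a \<le> (b - a) / (c * a)"
proof -
  have "a > 0" using \<theta> a by simp
  show ?thesis
  proof (cases "b = 0")
    case True
    have "0 \<le> ln (a / \<theta>)" using \<theta> a by (intro ln_ge_zero) simp
    then have "0 \<le> ln (a / \<theta>) / c" using c by simp
    then show ?thesis using True \<open>a > 0\<close> c by (simp add: relative_log_def add_divide_distrib)
  next
    case False
    then have "b > 0" using b \<theta> by auto
    have "ln (b / \<theta>) - ln (a / \<theta>) = ln (b / a)"
      using \<open>a > 0\<close> \<open>b > 0\<close> \<theta> by (simp add: ln_div)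
    also have "\<dots> \<le> b / a - 1" using \<open>a > 0\<close> \<open>b > 0\<close> by (intro ln_le_minus_one) simp
    finally have "(ln (b / \<theta>) - ln (a / \<theta>)) / c \<le> (b / a - 1) / c" using c by (intro divide_right_mono) auto
    also have "(b / a - 1) / c = (b - a) / (c * a)" using \<open>a > 0\<close> c by (simp add: field_simps)
    finally show ?thesis using False \<open>a > 0\<close> by (simp add: relative_log_def diff_divide_distrib add_divide_distrib)
  qed
qed

lemma relative_log_bounds:
  assumes c: "0 < c" and \<theta>: "0 < \<theta>" and v: "v = 0 \<or> \<theta> \<le> v" and m: "v \<le> m * \<theta>" "1 \<le> m"
  shows "0 \<le> relative_log c \<theta> v \<and> relative_log c \<theta> v \<le> (ln m + 1) / c"
proof (cases "v = 0")
  case True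
  then show ?thesis using c m by (simp add: relative_log_def)
next
  case False
  then have "1 \<le> v / \<theta>" "v / \<theta> \<le> m" using v m \<theta> by (auto simp: field_simps)
  then have "0 \<le> ln (v / \<theta>)" "ln (v / \<theta>) \<le> ln m" by auto
  then show ?thesis using False c by (auto simp: relative_log_def divide_right_mono)
qed

text \<open>
  Node \<open>1\<close> is the hub of the star. Its weight \<open>\<theta>\<close> below \<open>1\<close> rewards moving a state \<open>\<sigma>\<close> from a leaf to
  the hub, where it meets all other leaves.
\<close>

definition hub_weighted_count :: "nat \<Rightarrow> real \<Rightarrow> node_state \<Rightarrow> (nat \<Rightarrow> node_state) \<Rightarrow> real" where
  "hub_weighted_count n \<theta> \<sigma> x = \<theta> * of_bool (x 1 = \<sigma>) + (\<Sum>i\<in>{2..n}. of_bool (x i = \<sigma>))"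

lemma sum_update_pair:
  fixes f :: "nat \<Rightarrow> node_state \<Rightarrow> real"
  assumes "finite A" "i \<in> A" "j \<in> A" "i \<noteq> j"
  shows "(\<Sum>k\<in>A. f k (update_pair (i, j) x k)) = (\<Sum>k\<in>A. f k (x k))
     - f i (x i) - f j (x j) + f i (fst (interact (x i) (x j))) + f j (snd (interact (x i) (x j)))"
proof -
  have A: "A = insert i (insert j (A - {i, j}))" using assms by auto
  have eq: "(\<Sum>k\<in>A. h k) = h i + h j + (\<Sum>k\<in>A - {i, j}. h k)" for h :: "nat \<Rightarrow> real"
    using assms by (subst A) (simp add: add.assoc)
  have "(\<Sum>k\<in>A - {i, j}. f k (update_pair (i, j) x k)) = (\<Sum>k\<in>A - {i, j}. f k (x k))"
    by (intro sum.cong) (auto simp: update_pair_def)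
  then show ?thesis using assms unfolding eq[of "\<lambda>k. f k (x k)"] eq[of "\<lambda>k. f k (update_pair (i, j) x k)"]
    by (simp add: update_pair_def)
qed

definition surplus :: "nat \<Rightarrow> (nat \<Rightarrow> node_state) \<Rightarrow> real" where
  "surplus n x = (\<Sum>i\<in>{1..n}. of_bool (x i = S0) - of_bool (x i = S1))"

lemma surplus_update_pair:
  assumes "p \<in> node_pairs n"
  shows "surplus n (update_pair p x) = surplus n x"
proof -
  obtain i j where p: "p = (i, j)" "i \<in> {1..n}" "j \<in> {1..n}" "i \<noteq> j"
    using assms by (auto simp: node_pairs_def)
  then have "surplus n (update_pair p x) = surplus n x
     - (of_bool (x i = S0) - of_bool (x i = S1)) - (of_bool (x j = S0) - of_bool (x j = S1))
     + (of_bool (fst (interact (x i) (x j)) = S0) - of_bool (fst (interact (x i) (x j)) = S1))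
     + (of_bool (snd (interact (x i) (x j)) = S0) - of_bool (snd (interact (x i) (x j)) = S1))"
    unfolding surplus_def p(1) by (intro sum_update_pair) auto
  also have "\<dots> = surplus n x" by (cases "x i"; cases "x j") simp_all
  finally show ?thesis .
qed

lemma hub_weighted_count_update:
  assumes j: "j \<in> {2..n}"
  shows "hub_weighted_count n \<theta> \<sigma> (update_pair (1, j) x) - hub_weighted_count n \<theta> \<sigma> x =
     \<theta> * (of_bool (fst (interact (x 1) (x j)) = \<sigma>) - of_bool (x 1 = \<sigma>))
     + (of_bool (snd (interact (x 1) (x j)) = \<sigma>) - of_bool (x j = \<sigma>))"
proof -
  have eq: "hub_weighted_count n \<theta> \<sigma> y = (\<Sum>k\<in>{1..n}. (if k = 1 then \<theta> else 1) * of_bool (y k = \<sigma>))" for y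
  proof -
    have "{1..n} = insert 1 {2..n}" using j by auto
    then show ?thesis by (simp add: hub_weighted_count_def)
  qed
  show ?thesis
    unfolding eq using j by (subst sum_update_pair) (auto simp: algebra_simps)
qed

lemma hub_weighted_count_values:
  assumes "0 \<le> \<theta>" "\<theta> \<le> 1"
  shows "hub_weighted_count n \<theta> \<sigma> x = 0 \<or> \<theta> \<le> hub_weighted_count n \<theta> \<sigma> x"
proof (cases "\<exists>i\<in>{2..n}. x i = \<sigma>")
  case True
  then obtain i where i: "i \<in> {2..n}" "x i = \<sigma>" by blast
  have "(\<Sum>i\<in>{2..n}. of_bool (x i = \<sigma>) :: real) \<ge> of_bool (x i = \<sigma>)"
    using i by (intro member_le_sum) auto
  then show ?thesis using i assms by (simp add: hub_weighted_count_def)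
next
  case False
  then have "(\<Sum>i\<in>{2..n}. of_bool (x i = \<sigma>) :: real) = 0" by (intro sum.neutral) auto
  then show ?thesis by (simp add: hub_weighted_count_def)
qed

lemma hub_weighted_count_eq_0_iff:
  assumes "0 < \<theta>" "1 \<le> n"
  shows "hub_weighted_count n \<theta> \<sigma> x = 0 \<longleftrightarrow> (\<forall>i\<in>{1..n}. x i \<noteq> \<sigma>)"
proof -
  have nn: "0 \<le> (\<Sum>i\<in>{2..n}. of_bool (x i = \<sigma>) :: real)" by (intro sum_nonneg) simp
  have "hub_weighted_count n \<theta> \<sigma> x = 0 \<longleftrightarrow> x 1 \<noteq> \<sigma> \<and> (\<Sum>i\<in>{2..n}. of_bool (x i = \<sigma>) :: real) = 0"
    using assms nn by (auto simp: hub_weighted_count_def add_nonneg_eq_0_iff)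
  also have "(\<Sum>i\<in>{2..n}. of_bool (x i = \<sigma>) :: real) = 0 \<longleftrightarrow> (\<forall>i\<in>{2..n}. x i \<noteq> \<sigma>)"
    by (subst sum_nonneg_eq_0_iff) auto
  also have "x 1 \<noteq> \<sigma> \<and> (\<forall>i\<in>{2..n}. x i \<noteq> \<sigma>) \<longleftrightarrow> (\<forall>i\<in>{1..n}. x i \<noteq> \<sigma>)"
  proof -
    have "{1..n} = insert 1 {2..n}" using assms by auto
    then show ?thesis by simp
  qed
  finally show ?thesis .
qed

text \<open>
  The change by a contact with a leaf is linear in the indicators that the leaf is in \<^const>\<open>S0\<close> and in
  \<open>\<sigma>\<close>, so the sum over the leaves depends only on the two counts. If the hub is in \<open>\<sigma>\<close>, the sum is
  \<open>c * (n - 1) - z - c * a\<close> with \<open>z\<close> leaves in \<^const>\<open>S0\<close> and \<open>a\<close> in \<open>\<sigma>\<close>, and the surplus gives \<open>z \<ge> c * n\<close>.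
  The weight \<open>1 - c\<close> of the hub is what makes the decay rate exactly \<open>c\<close> for a hub in a weak state.
\<close>

lemma hub_weighted_drift:
  assumes n: "2 \<le> n" and c: "0 < c" "c \<le> 1" and surplus: "surplus n x = c * real n"
    and phase: "\<sigma> = S1 \<or> \<sigma> = E1 \<and> (\<forall>i\<in>{1..n}. x i \<noteq> S1)"
  shows "(\<Sum>j\<in>{2..n}. hub_weighted_count n (1 - c) \<sigma> (update_pair (1, j) x) - hub_weighted_count n (1 - c) \<sigma> x)
     \<le> - (c * hub_weighted_count n (1 - c) \<sigma> x)"
proof -
  let ?h = "x 1"
  define a z b where "a = (\<Sum>i\<in>{2..n}. of_bool (x i = \<sigma>) :: real)"
    and "z = (\<Sum>i\<in>{2..n}. of_bool (x i = S0) :: real)" and "b = (\<Sum>i\<in>{2..n}. of_bool (x i = S1) :: real)"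
  have nn: "0 \<le> a" "0 \<le> b" unfolding a_def b_def by (intro sum_nonneg; simp)+
  have ins: "{1..n} = insert 1 {2..n}" using n by auto
  have split: "(\<Sum>i\<in>{1..n}. f i) = f 1 + (\<Sum>i\<in>{2..n}. f i)" for f :: "nat \<Rightarrow> real"
    unfolding ins by (rule sum.insert) auto
  have sur: "of_bool (?h = S0) - of_bool (?h = S1) + z - b = c * real n"
    using surplus unfolding surplus_def split sum_subtractf z_def b_def by linarith
  have V: "hub_weighted_count n (1 - c) \<sigma> x = (1 - c) * of_bool (?h = \<sigma>) + a"
    by (simp add: hub_weighted_count_def a_def)
  define d where "d l = (1 - c) * (of_bool (fst (interact ?h l) = \<sigma>) - of_bool (?h = \<sigma>))
     + (of_bool (snd (interact ?h l) = \<sigma>) - of_bool (l = \<sigma>))" for l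
  have total: "(\<Sum>j\<in>{2..n}. hub_weighted_count n (1 - c) \<sigma> (update_pair (1, j) x) - hub_weighted_count n (1 - c) \<sigma> x)
      = (\<Sum>j\<in>{2..n}. d (x j))"
    by (intro sum.cong refl) (simp only: hub_weighted_count_update d_def)
  have linear: "(\<Sum>j\<in>{2..n}. d (x j)) = u * (real n - 1) + v * z + w * a"
    if "\<And>j. j \<in> {2..n} \<Longrightarrow> d (x j) = u + v * of_bool (x j = S0) + w * of_bool (x j = \<sigma>)" for u v w
  proof -
    have "(\<Sum>j\<in>{2..n}. d (x j)) = (\<Sum>j\<in>{2..n}. u + v * of_bool (x j = S0) + w * of_bool (x j = \<sigma>))"
      using that by (intro sum.cong) auto
    also have "\<dots> = u * (real n - 1) + v * z + w * a"
      using n by (simp add: sum.distrib sum_distrib_left[symmetric] z_def a_def of_nat_diff)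
    finally show ?thesis .
  qed
  have leaf: "x j \<noteq> S1" "?h \<noteq> S1" if "\<sigma> = E1" "j \<in> {2..n}" for j
    using phase that n by auto
  have ones: "\<sigma> = S1 \<Longrightarrow> b = a" "\<sigma> = E1 \<Longrightarrow> b = 0"
    using leaf by (auto simp: b_def a_def)
  have sigma: "\<sigma> = S1 \<or> \<sigma> = E1" using phase by auto
  consider "?h = \<sigma>" | "?h = S0" | "?h \<noteq> \<sigma>" "?h \<noteq> S0" by blast
  then show ?thesis
  proof cases
    case 1
    have "d (x j) = c + (- 1) * of_bool (x j = S0) + (- c) * of_bool (x j = \<sigma>)" if "j \<in> {2..n}" for j
      using sigma 1 leaf[OF _ that] by (cases "x j") (auto simp: d_def)
    from linear[OF this] have "(\<Sum>j\<in>{2..n}. d (x j)) = c * (real n - 1) - z - c * a" by simp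
    moreover have "z \<ge> c * real n" using sur sigma 1 ones nn by auto
    moreover have "0 \<le> c * c" by simp
    moreover have "c * ((1 - c) * 1 + a) = c - c * c + c * a" "c * (real n - 1) = c * real n - c"
      by (simp_all add: algebra_simps)
    ultimately have "(\<Sum>j\<in>{2..n}. d (x j)) \<le> - (c * ((1 - c) * 1 + a))" by linarith
    then show ?thesis unfolding total unfolding V using 1 by simp
  next
    case 2
    have "d (x j) = 0 + 0 * of_bool (x j = S0) + (- 1) * of_bool (x j = \<sigma>)" if "j \<in> {2..n}" for j
      using sigma 2 leaf[OF _ that] by (cases "x j") (auto simp: d_def)
    from linear[OF this] have "(\<Sum>j\<in>{2..n}. d (x j)) = - a" by simp
    moreover have "c * a \<le> a" using c nn by (simp add: mult_left_le_one_le)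
    ultimately show ?thesis unfolding total unfolding V using 2 sigma by auto
  next
    case 3
    have "d (x j) = 0 + 0 * of_bool (x j = S0) + (- c) * of_bool (x j = \<sigma>)" if "j \<in> {2..n}" for j
      using sigma 3 leaf[OF _ that] by (cases "x j"; cases "x 1") (auto simp: d_def)
    from linear[OF this] have "(\<Sum>j\<in>{2..n}. d (x j)) = - (c * a)" by simp
    then show ?thesis unfolding total unfolding V using 3 by simp
  qed
qed


lemma star_rates_total:
  assumes n: "1 < n"
  shows "(\<Sum>p\<in>node_pairs n. star_rates n (fst p) (snd p) * f p) = (\<Sum>j\<in>{2..n}. f (1, j)) / (real n - 1)"
proof -
  have "(\<Sum>p\<in>node_pairs n. star_rates n (fst p) (snd p) * f p) =
      (\<Sum>p\<in>(\<lambda>j. (1, j)) ` {2..n}. star_rates n (fst p) (snd p) * f p)"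
    using n finite_node_pairs by (intro sum.mono_neutral_right) (auto simp: node_pairs_def star_rates_def image_iff)
  also have "\<dots> = (\<Sum>j\<in>{2..n}. star_rates n 1 j * f (1, j))"
    by (subst sum.reindex) (auto simp: inj_on_def)
  also have "\<dots> = (\<Sum>j\<in>{2..n}. f (1, j) / (real n - 1))"
    by (intro sum.cong) (auto simp: star_rates_def)
  finally show ?thesis by (simp add: sum_divide_distrib)
qed

definition phase1_over :: "nat \<Rightarrow> (nat \<Rightarrow> node_state) \<Rightarrow> bool" where
  "phase1_over n x \<longleftrightarrow> (\<forall>i\<in>{1..n}. x i \<noteq> S1)"

definition phase2_over :: "nat \<Rightarrow> (nat \<Rightarrow> node_state) \<Rightarrow> bool" where
  "phase2_over n x \<longleftrightarrow> phase1_over n x \<and> (\<forall>i\<in>{1..n}. x i \<noteq> E1)"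

lemma phase1_over_update:
  assumes p: "p \<in> node_pairs n" and x: "phase1_over n x"
  shows "phase1_over n (update_pair p x)"
proof -
  obtain i j where ij: "p = (i, j)" "i \<in> {1..n}" "j \<in> {1..n}" using p by (auto simp: node_pairs_def)
  then have "x i \<noteq> S1" "x j \<noteq> S1" using x by (auto simp: phase1_over_def)
  then have "fst (interact (x i) (x j)) \<noteq> S1 \<and> snd (interact (x i) (x j)) \<noteq> S1"
    by (cases "x i"; cases "x j") simp_all
  then show ?thesis using x ij by (auto simp: phase1_over_def update_pair_def)
qed

lemma phase2_over_update:
  assumes p: "p \<in> node_pairs n" and x: "phase2_over n x"
  shows "phase2_over n (update_pair p x)"
proof -
  obtain i j where ij: "p = (i, j)" "i \<in> {1..n}" "j \<in> {1..n}" using p by (auto simp: node_pairs_def)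
  then have "x i \<noteq> S1" "x j \<noteq> S1" "x i \<noteq> E1" "x j \<noteq> E1" using x by (auto simp: phase1_over_def phase2_over_def)
  then have "fst (interact (x i) (x j)) \<noteq> E1 \<and> snd (interact (x i) (x j)) \<noteq> E1"
    by (cases "x i"; cases "x j") simp_all
  then show ?thesis using x ij phase1_over_update[OF p, of x] by (auto simp: phase2_over_def update_pair_def)
qed

lemma hub_weighted_count_absent: "1 \<le> n \<Longrightarrow> \<forall>i\<in>{1..n}. x i \<noteq> \<sigma> \<Longrightarrow> hub_weighted_count n \<theta> \<sigma> x = 0"
  by (auto simp: hub_weighted_count_def)

lemma count_le_surplus:
  assumes "\<sigma> \<noteq> S0"
  shows "(\<Sum>i\<in>{1..n}. of_bool (x i = \<sigma>)) \<le> real n - surplus n x"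
proof -
  have "(\<Sum>i\<in>{1..n}. of_bool (x i = \<sigma>) :: real) \<le> (\<Sum>i\<in>{1..n}. 1 - (of_bool (x i = S0) - of_bool (x i = S1)))"
    using assms by (intro sum_mono) auto
  also have "\<dots> = real n - surplus n x" unfolding surplus_def sum_subtractf by simp
  finally show ?thesis .
qed

text \<open>
  If all nodes are in \<^const>\<open>S0\<close>, then \<open>c = 1\<close> and the weight \<open>1 - c\<close> of the hub is \<open>0\<close>. It is positive as soon
  as another state is present.
\<close>

lemma surplus_fraction_less_1:
  assumes "surplus n x = c * real n" "i \<in> {1..n}" "x i = \<sigma>" "\<sigma> \<noteq> S0"
  shows "c < 1"
proof -
  have "(\<Sum>i\<in>{1..n}. of_bool (x i = \<sigma>) :: real) \<ge> of_bool (x i = \<sigma>)"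
    using assms by (intro member_le_sum) auto
  with count_le_surplus[OF assms(4), where n = n and x = x] assms have "1 \<le> (1 - c) * real n"
    by (simp add: algebra_simps del: sum_of_bool_eq)
  then have "0 < (1 - c) * real n" by linarith
  then show ?thesis by (auto simp: zero_less_mult_iff)
qed

text \<open>
  At least \<open>c * n\<close> nodes are in \<^const>\<open>S0\<close>, so at most \<open>(1 - c) * n\<close> are in any other state.
\<close>

lemma hub_weighted_count_le:
  assumes "1 \<le> n" "0 \<le> c" "surplus n x = c * real n" "\<sigma> \<noteq> S0"
  shows "hub_weighted_count n (1 - c) \<sigma> x \<le> real n * (1 - c)"
proof -
  have "{1..n} = insert 1 {2..n}" using assms by auto
  then have "(\<Sum>i\<in>{1..n}. of_bool (x i = \<sigma>) :: real) = of_bool (x 1 = \<sigma>) + (\<Sum>i\<in>{2..n}. of_bool (x i = \<sigma>))"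
    by (simp del: sum_of_bool_eq)
  moreover have "(1 - c) * of_bool (x 1 = \<sigma>) \<le> of_bool (x 1 = \<sigma>)" using assms by simp
  ultimately show ?thesis
    using count_le_surplus[OF assms(4), where n = n and x = x] assms(3)
    unfolding hub_weighted_count_def by (simp add: algebra_simps del: sum_of_bool_eq)
qed

text \<open>
  The factor \<open>n - 1\<close> undoes the contact rate \<open>1 / (n - 1)\<close> of each leaf.
\<close>

definition phase_potential :: "nat \<Rightarrow> real \<Rightarrow> node_state \<Rightarrow> (nat \<Rightarrow> node_state) \<Rightarrow> real" where
  "phase_potential n c \<sigma> x = (real n - 1) * relative_log c (1 - c) (hub_weighted_count n (1 - c) \<sigma> x)"

lemma phase_potential_bounds:
  assumes n: "1 < n" and c: "0 < c" "c \<le> 1" and x: "surplus n x = c * real n" and \<sigma>: "\<sigma> \<noteq> S0"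
  shows "0 \<le> phase_potential n c \<sigma> x \<and> phase_potential n c \<sigma> x \<le> (real n - 1) * ((ln (real n) + 1) / c)"
proof -
  have "0 \<le> relative_log c (1 - c) (hub_weighted_count n (1 - c) \<sigma> x) \<and>
    relative_log c (1 - c) (hub_weighted_count n (1 - c) \<sigma> x) \<le> (ln (real n) + 1) / c"
  proof (cases "\<forall>i\<in>{1..n}. x i \<noteq> \<sigma>")
    case True
    then show ?thesis using hub_weighted_count_absent[of n x \<sigma>] n c by (simp add: relative_log_def)
  next
    case False
    then have "c < 1" using surplus_fraction_less_1[OF x] \<sigma> by blast
    then show ?thesis
      using hub_weighted_count_le[OF _ _ x \<sigma>] hub_weighted_count_values[of "1 - c" n \<sigma> x] n c
      by (intro relative_log_bounds) auto
  qed
  then show ?thesis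
    using n unfolding phase_potential_def by (intro conjI mult_nonneg_nonneg mult_left_mono) auto
qed

text \<open>
  While \<open>\<sigma>\<close> is present, the tangent of the logarithm at the present count turns the drift
  \<open>- c * V\<close> of the count \<open>V\<close> into \<open>- c * V / (c * V) = - 1\<close>. Once \<open>\<sigma>\<close> is gone it does not reappear
  in the phase in question.
\<close>

lemma phase_potential_drift:
  assumes n: "1 < n" and c: "0 < c" "c \<le> 1" and x: "surplus n x = c * real n"
    and phase: "\<sigma> = S1 \<or> \<sigma> = E1 \<and> phase1_over n x"
  shows "(\<Sum>p\<in>node_pairs n. star_rates n (fst p) (snd p) *
      (phase_potential n c \<sigma> (update_pair p x) - phase_potential n c \<sigma> x)) \<le> - of_bool (\<exists>i\<in>{1..n}. x i = \<sigma>)"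
proof -
  let ?V = "hub_weighted_count n (1 - c) \<sigma>"
  let ?r = "relative_log c (1 - c)"
  have "(\<Sum>p\<in>node_pairs n. star_rates n (fst p) (snd p) *
      (phase_potential n c \<sigma> (update_pair p x) - phase_potential n c \<sigma> x)) =
      (\<Sum>j\<in>{2..n}. phase_potential n c \<sigma> (update_pair (1, j) x) - phase_potential n c \<sigma> x) / (real n - 1)"
    by (rule star_rates_total[OF n])
  also have "\<dots> = (\<Sum>j\<in>{2..n}. ?r (?V (update_pair (1, j) x)) - ?r (?V x))"
    using n unfolding phase_potential_def right_diff_distrib[symmetric] sum_distrib_left[symmetric] by simp
  also have "\<dots> \<le> - of_bool (\<exists>i\<in>{1..n}. x i = \<sigma>)"
  proof (cases "\<exists>i\<in>{1..n}. x i = \<sigma>")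
    case True
    have "\<sigma> \<noteq> S0" using phase by auto
    then have c1: "c < 1" using True surplus_fraction_less_1[OF x] by blast
    have "?V x \<noteq> 0" using True c1 n by (subst hub_weighted_count_eq_0_iff) auto
    then have V: "1 - c \<le> ?V x" using hub_weighted_count_values[of "1 - c" n \<sigma> x] c by auto
    have "(\<Sum>j\<in>{2..n}. ?r (?V (update_pair (1, j) x)) - ?r (?V x)) \<le> (\<Sum>j\<in>{2..n}. (?V (update_pair (1, j) x) - ?V x) / (c * ?V x))"
      using c c1 V hub_weighted_count_values[of "1 - c" n \<sigma>] by (intro sum_mono relative_log_tangent) auto
    also have "\<dots> = (\<Sum>j\<in>{2..n}. ?V (update_pair (1, j) x) - ?V x) / (c * ?V x)"
      by (simp add: sum_divide_distrib)
    also have "\<dots> \<le> - (c * ?V x) / (c * ?V x)"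
      using hub_weighted_drift[OF _ c x, of \<sigma>] n phase c V c1 by (intro divide_right_mono) (auto simp: phase1_over_def)
    also have "\<dots> = - 1" using c V c1 by simp
    finally show ?thesis using True by simp
  next
    case False
    have "?V (update_pair (1, j) x) = 0" if "j \<in> {2..n}" for j
    proof -
      have p: "(1, j) \<in> node_pairs n" using that by (auto simp: node_pairs_def)
      have "\<forall>i\<in>{1..n}. update_pair (1, j) x i \<noteq> \<sigma>"
        using phase
      proof
        assume "\<sigma> = S1"
        then show ?thesis using False phase1_over_update[OF p, of x] by (auto simp: phase1_over_def)
      next
        assume "\<sigma> = E1 \<and> phase1_over n x"
        then show ?thesis using False phase2_over_update[OF p, of x] by (auto simp: phase2_over_def)
      qed
      then show ?thesis using n by (intro hub_weighted_count_absent) auto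
    qed
    moreover have "?V x = 0" using False n by (intro hub_weighted_count_absent) auto
    ultimately show ?thesis using False by simp
  qed
  finally show ?thesis .
qed

section \<open>The two phases\<close>

lemma absorbing_phase1_over: "absorbing n (phase1_over n)"
  by (simp add: absorbing_def phase1_over_update)

lemma absorbing_phase2_over: "absorbing n (phase2_over n)"
  by (simp add: absorbing_def phase2_over_update)

lemma phase1_duration_eq_hitting_time: "phase1_duration n x0 c = hitting_time n x0 c (phase1_over n)"
  by (simp add: phase1_duration_def hitting_time_def phase1_over_def)

text \<open>
  Phase 2 ends when the conjunction of both end conditions is reached, which is a hitting time.
  This needs that the first condition already holds at the end of phase 1 itself, where the set of
  admissible \<open>s\<close> contains \<open>0\<close>.
\<close>

lemma phase2_duration_eq:
  assumes c: "regular_paths n c" and t: "phase1_duration n x0 c = ennreal t" "0 \<le> t"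
  shows "phase2_duration n x0 c = hitting_time n x0 c (phase2_over n) - phase1_duration n x0 c"
proof -
  have dur: "phase2_duration n x0 c = Inf {ennreal s |s. 0 \<le> s \<and> (\<forall>i\<in>{1..n}. consensus_state n x0 c (t + s) i \<noteq> E1)}"
    unfolding phase2_duration_def t(1) using t(2) by (intro arg_cong[of _ _ Inf]) auto
  have at_t: "phase1_over n (consensus_state n x0 c t)"
    using t unfolding phase1_duration_eq_hitting_time by (rule hitting_time_attained[OF c absorbing_phase1_over])
  have over1: "phase1_over n (consensus_state n x0 c (t + s))" if "0 \<le> s" for s
    by (rule absorbing_stays[OF c absorbing_phase1_over _ at_t]) (use that in simp)
  show ?thesis
  proof (rule antisym)
    have "ennreal t + phase2_duration n x0 c \<le> hitting_time n x0 c (phase2_over n)"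
      unfolding hitting_time_def
    proof (rule Inf_greatest, safe)
      fix u :: real assume u: "0 \<le> u" "phase2_over n (consensus_state n x0 c u)"
      then have "phase1_duration n x0 c \<le> ennreal u"
        unfolding phase1_duration_eq_hitting_time by (intro hitting_time_le) (simp_all add: phase2_over_def)
      then have "t \<le> u" using t u by (simp add: ennreal_le_iff)
      then have "phase2_duration n x0 c \<le> ennreal (u - t)"
        unfolding dur using u by (intro Inf_lower) (auto simp: phase2_over_def)
      then have "ennreal t + phase2_duration n x0 c \<le> ennreal t + ennreal (u - t)" by (rule add_left_mono)
      also have "\<dots> = ennreal u" using t \<open>t \<le> u\<close> by (simp add: ennreal_plus[symmetric] del: ennreal_plus)
      finally show "ennreal t + phase2_duration n x0 c \<le> ennreal u" .
    qed
    then have "ennreal t + phase2_duration n x0 c - ennreal t \<le> hitting_time n x0 c (phase2_over n) - ennreal t"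
      by (rule ennreal_minus_mono) simp
    then show "phase2_duration n x0 c \<le> hitting_time n x0 c (phase2_over n) - phase1_duration n x0 c"
      unfolding t(1) by simp
    show "hitting_time n x0 c (phase2_over n) - phase1_duration n x0 c \<le> phase2_duration n x0 c"
      unfolding dur t(1)
    proof (rule Inf_greatest, safe)
      fix s :: real assume s: "0 \<le> s" "\<forall>i\<in>{1..n}. consensus_state n x0 c (t + s) i \<noteq> E1"
      then have "hitting_time n x0 c (phase2_over n) \<le> ennreal (t + s)"
        using over1 t by (intro hitting_time_le) (simp_all add: phase2_over_def)
      then have "hitting_time n x0 c (phase2_over n) - ennreal t \<le> ennreal (t + s) - ennreal t"
        by (intro ennreal_minus_mono) simp_all
      also have "\<dots> = ennreal s" using t s by (simp add: ennreal_minus)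
      finally show "hitting_time n x0 c (phase2_over n) - ennreal t \<le> ennreal s" .
    qed
  qed
qed

lemma during_phase1:
  assumes "0 \<le> t" "ennreal t < phase1_duration n x0 c"
  shows "\<exists>i\<in>{1..n}. consensus_state n x0 c t i = S1"
  using hitting_time_le[OF assms(1), of "phase1_over n" n x0 c] assms(2)
  unfolding phase1_duration_eq_hitting_time by (force simp: phase1_over_def)

lemma during_phase2:
  assumes c: "regular_paths n c" and u: "0 \<le> u" "phase1_duration n x0 c < ennreal u"
    "ennreal u < phase1_duration n x0 c + phase2_duration n x0 c"
  shows "phase1_over n (consensus_state n x0 c u) \<and> (\<exists>i\<in>{1..n}. consensus_state n x0 c u i = E1)"
proof -
  have over1: "phase1_over n (consensus_state n x0 c u)"
    using u(2) unfolding phase1_duration_eq_hitting_time by (rule hitting_time_less[OF c absorbing_phase1_over])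
  obtain t where t: "phase1_duration n x0 c = ennreal t" "0 \<le> t"
    using u(2) by (cases "phase1_duration n x0 c") auto
  then have "t < u" using u by (simp add: ennreal_less_iff)
  have False if "\<forall>i\<in>{1..n}. consensus_state n x0 c u i \<noteq> E1"
  proof -
    have "phase2_duration n x0 c \<le> ennreal (u - t)"
      unfolding phase2_duration_def
      by (intro Inf_lower CollectI exI[of _ "u - t"] exI[of _ t]) (use t \<open>t < u\<close> that in simp)
    then have "ennreal t + phase2_duration n x0 c \<le> ennreal t + ennreal (u - t)" by (rule add_left_mono)
    also have "\<dots> = ennreal u" using t \<open>t < u\<close> by (simp add: ennreal_plus[symmetric] del: ennreal_plus)
    finally show False using u t by simp
  qed
  then show ?thesis using over1 by blast
qed

theorem corollary4:
  fixes M :: "'a measure" and n :: nat and \<alpha> :: real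
    and N :: "nat \<times> nat \<Rightarrow> real \<Rightarrow> 'a \<Rightarrow> nat"
    and x0 :: "nat \<Rightarrow> node_state"
  assumes "n > 1"
    and "1 / 2 < \<alpha>" and "\<alpha> \<le> 1"
    and "pairwise_contacts M n (star_rates n) N"
    and "real (card {i \<in> {1..n}. x0 i = S0}) = \<alpha> * real n"
    and "real (card {i \<in> {1..n}. x0 i = S1}) = (1 - \<alpha>) * real n"
  shows "\<forall>duration \<in> {phase1_duration, phase2_duration}.
           (\<lambda>\<omega>. duration n x0 (\<lambda>p t. N p t \<omega>)) \<in> borel_measurable (completion M) \<and>
           (\<integral>\<^sup>+ \<omega>. duration n x0 (\<lambda>p t. N p t \<omega>) \<partial>M)
             \<le> ennreal (1 / (2 * \<alpha> - 1) * (real n * (ln (real n) + 1)))"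
proof -
  interpret pairwise_contacts M n "star_rates n" N by fact
  define c where "c = 2 * \<alpha> - 1"
  define C where "C = (real n - 1) * ((ln (real n) + 1) / c)"
  have n: "1 < n" and c: "0 < c" "c \<le> 1" using assms by (auto simp: c_def)
  let ?I = "\<lambda>x. surplus n x = c * real n"
  have inv: "?I (update_pair p x)" if "p \<in> node_pairs n" "?I x" for p x
    using that by (simp add: surplus_update_pair)
  have "surplus n x0 = real (card {i \<in> {1..n}. x0 i = S0}) - real (card {i \<in> {1..n}. x0 i = S1})"
    by (simp add: surplus_def sum_subtractf Int_def)
  then have init: "?I x0" using assms by (simp add: c_def algebra_simps)
  have pot: "0 \<le> phase_potential n c \<sigma> x \<and> phase_potential n c \<sigma> x \<le> C" if "?I x" "\<sigma> \<noteq> S0" for \<sigma> x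
    unfolding C_def using n c that by (rule phase_potential_bounds)
  have C_le: "C \<le> 1 / (2 * \<alpha> - 1) * (real n * (ln (real n) + 1))"
  proof -
    have "C = (real n - 1) * (ln (real n) + 1) / c" by (simp add: C_def)
    also have "\<dots> \<le> real n * (ln (real n) + 1) / c"
      using n c by (intro divide_right_mono mult_right_mono) auto
    finally show ?thesis by (simp add: c_def)
  qed
  let ?T1 = "\<lambda>\<omega>. phase1_duration n x0 (paths \<omega>)" and ?T2 = "\<lambda>\<omega>. phase2_duration n x0 (paths \<omega>)"
  have m1: "?T1 \<in> borel_measurable (completion M)"
    unfolding phase1_duration_eq_hitting_time by (rule measurable_hitting_time[OF absorbing_phase1_over])
  have "(\<integral>\<^sup>+ \<omega>. ?T1 \<omega> \<partial>M) \<le> ennreal (phase_potential n c S1 x0)"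
  proof (rule expected_sojourn_le[where S = "\<lambda>_. 0" and I = ?I and C = C and B = "\<lambda>x. \<exists>i\<in>{1..n}. x i = S1"])
    show "\<And>x. ?I x \<Longrightarrow> (\<Sum>p\<in>node_pairs n. star_rates n (fst p) (snd p) *
        (phase_potential n c S1 (update_pair p x) - phase_potential n c S1 x)) \<le> - of_bool (\<exists>i\<in>{1..n}. x i = S1)"
      by (rule phase_potential_drift[OF n c]) auto
    show "\<And>\<omega> t. 0 \<le> t \<Longrightarrow> ennreal t < 0 + ?T1 \<omega> \<Longrightarrow> \<exists>i\<in>{1..n}. consensus_state n x0 (paths \<omega>) t i = S1"
      using during_phase1 by simp
  qed (use m1 init inv pot in auto)
  also have "\<dots> \<le> ennreal C" using pot[OF init, of S1] by (intro ennreal_leI) auto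
  finally have E1: "(\<integral>\<^sup>+ \<omega>. ?T1 \<omega> \<partial>M) \<le> ennreal C" .
  have fin: "AE \<omega> in M. ?T1 \<omega> < top"
  proof -
    have "AE \<omega> in completion M. ?T1 \<omega> \<noteq> \<infinity>"
      using E1 by (intro nn_integral_PInf_AE[OF m1]) (auto simp: nn_integral_completion top_unique)
    then show ?thesis unfolding AE_completion_iff by eventually_elim (simp add: less_top)
  qed
  have m2: "?T2 \<in> borel_measurable (completion M)"
  proof (rule borel_measurable_completion_AE_eq)
    show "(\<lambda>\<omega>. hitting_time n x0 (paths \<omega>) (phase2_over n) - ?T1 \<omega>) \<in> borel_measurable (completion M)"
      using m1 measurable_hitting_time[OF absorbing_phase2_over, of x0] by measurable
    show "AE \<omega> in M. hitting_time n x0 (paths \<omega>) (phase2_over n) - ?T1 \<omega> = ?T2 \<omega>"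
      using fin AE_regular_paths
    proof eventually_elim
      fix \<omega> assume "?T1 \<omega> < top" and reg: "regular_paths n (paths \<omega>)"
      then obtain t where "?T1 \<omega> = ennreal t" "0 \<le> t" by (cases "?T1 \<omega>") auto
      then show "hitting_time n x0 (paths \<omega>) (phase2_over n) - ?T1 \<omega> = ?T2 \<omega>"
        by (rule phase2_duration_eq[OF reg, symmetric])
    qed
  qed
  \<comment> \<open>Entering phase 2 can only decrease this potential, whatever the configuration then is.\<close>
  let ?g = "\<lambda>x. if phase1_over n x then phase_potential n c E1 x else C"
  have g_bound: "0 \<le> ?g x \<and> ?g x \<le> C" if "?I x" for x
    using pot[OF that, of E1] by auto
  have "(\<integral>\<^sup>+ \<omega>. ?T2 \<omega> \<partial>M) \<le> ennreal (?g x0)"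
  proof (rule expected_sojourn_le[where S = ?T1 and I = ?I and C = C
        and B = "\<lambda>x. phase1_over n x \<and> (\<exists>i\<in>{1..n}. x i = E1)"])
    fix x assume x: "?I x"
    show "(\<Sum>p\<in>node_pairs n. star_rates n (fst p) (snd p) * (?g (update_pair p x) - ?g x))
        \<le> - of_bool (phase1_over n x \<and> (\<exists>i\<in>{1..n}. x i = E1))"
    proof (cases "phase1_over n x")
      case True
      then have "(\<Sum>p\<in>node_pairs n. star_rates n (fst p) (snd p) * (?g (update_pair p x) - ?g x)) =
        (\<Sum>p\<in>node_pairs n. star_rates n (fst p) (snd p) * (phase_potential n c E1 (update_pair p x) - phase_potential n c E1 x))"
        by (intro sum.cong) (auto simp: phase1_over_update)
      also have "\<dots> \<le> - of_bool (\<exists>i\<in>{1..n}. x i = E1)"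
        using True by (intro phase_potential_drift[OF n c x]) simp
      finally show ?thesis using True by simp
    next
      case False
      have "(\<Sum>p\<in>node_pairs n. star_rates n (fst p) (snd p) * (?g (update_pair p x) - ?g x)) \<le> (\<Sum>p\<in>node_pairs n. 0)"
      proof (rule sum_mono)
        fix p assume p: "p \<in> node_pairs n"
        have "?g (update_pair p x) \<le> C" using g_bound[OF inv[OF p x]] by blast
        moreover have "?g x = C" using False by simp
        ultimately have "?g (update_pair p x) - ?g x \<le> 0" by linarith
        then show "star_rates n (fst p) (snd p) * (?g (update_pair p x) - ?g x) \<le> 0"
          using pair_rate_nonneg[OF p] by (rule mult_nonneg_nonpos[rotated])
      qed
      then show ?thesis using False by simp
    qed
  qed (use m1 m2 fin init inv g_bound during_phase2 in auto)
  also have "\<dots> \<le> ennreal C" using g_bound[OF init] by (intro ennreal_leI) auto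
  finally have E2: "(\<integral>\<^sup>+ \<omega>. ?T2 \<omega> \<partial>M) \<le> ennreal C" .
  have "ennreal C \<le> ennreal (1 / (2 * \<alpha> - 1) * (real n * (ln (real n) + 1)))"
    using C_le by (rule ennreal_leI)
  then show ?thesis using m1 m2 E1 E2 by (auto intro: order_trans)
qed

end
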